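(* Let $\Psi$ be the scorpion property, i.e. the class of all scorpion graphs. Then $\Psi$ is not meager, and the following problem can be solved in time $O(n^4)$: given an $n$-vertex (finite, simple, undirected) graph $G$ and $k \in \mathbb{N}$, compute the number of $k$-element subsets $X\subseteq V(G)$ such that $G[X]$ is a scorpion.
   Context: Graphs are finite, simple and undirected. A graph $H$ is a scorpion if it can be obtained from an arbitrary graph $H'$ with $|V(H')|\ge 2$ by adding three fresh vertices $b,t,s$, making $b$ adjacent to all vertices of $H'$, and adding the edges $bt$ and $ts$ (and no other edges). A graph property $\Phi$ is an isomorphism-invariant map from graphs to $\{0,1\}$ (identified with the class of graphs mapped to $1$). Its restriction $\Phi^{(k)}$ to $k$-vertex graphs is trivial if it holds for all $k$-vertex graphs or for none. $\Phi$ is meager if $\Phi^{(k)}$ is trivial for all but finitely many $k\in\mathbb{N}$. The constant hidden in the $O$-notation is independent of $k$. *)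

theory Defs
  imports Complex_Main "HOL-Library.Landau_Symbols"
begin

section \<open>Graphs and graph properties\<close>

datatype 'a graph = Graph (verts: "'a set") (edges: "'a set set")

definition simple_graph :: "'a graph \<Rightarrow> bool" where
  "simple_graph G \<longleftrightarrow> finite (verts G) \<and> (\<forall>e\<in>edges G. e \<subseteq> verts G \<and> card e = 2)"

definition induced :: "'a graph \<Rightarrow> 'a set \<Rightarrow> 'a graph" where
  "induced G X = Graph X {e \<in> edges G. e \<subseteq> X}"

definition graph_iso :: "'a graph \<Rightarrow> 'b graph \<Rightarrow> bool" where
  "graph_iso G H \<longleftrightarrow> (\<exists>f. bij_betw f (verts G) (verts H) \<and> edges H = (\<lambda>e. f ` e) ` edges G)"

definition graph_property :: "('a graph \<Rightarrow> bool) \<Rightarrow> bool" where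
  "graph_property \<Phi> \<longleftrightarrow>
     (\<forall>G H. simple_graph G \<longrightarrow> simple_graph H \<longrightarrow> graph_iso G H \<longrightarrow> \<Phi> G = \<Phi> H)"

text \<open>Vertices are natural numbers from here on where all graphs of a given order are meant:
  every finite graph is isomorphic to one with vertices in \<^typ>\<open>nat\<close>.\<close>

definition trivial_at :: "(nat graph \<Rightarrow> bool) \<Rightarrow> nat \<Rightarrow> bool" where
  "trivial_at \<Phi> k \<longleftrightarrow>
     (\<forall>G. simple_graph G \<longrightarrow> card (verts G) = k \<longrightarrow> \<Phi> G) \<or>
     (\<forall>G. simple_graph G \<longrightarrow> card (verts G) = k \<longrightarrow> \<not> \<Phi> G)"

definition meager :: "(nat graph \<Rightarrow> bool) \<Rightarrow> bool" where
  "meager \<Phi> \<longleftrightarrow> finite {k. \<not> trivial_at \<Phi> k}"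

definition scorpion :: "'a graph \<Rightarrow> bool" where
  "scorpion H \<longleftrightarrow>
     (\<exists>H' b t s. simple_graph H' \<and> card (verts H') \<ge> 2 \<and>
        b \<notin> verts H' \<and> t \<notin> verts H' \<and> s \<notin> verts H' \<and> distinct [b, t, s] \<and>
        verts H = verts H' \<union> {b, t, s} \<and>
        edges H = edges H' \<union> {{b, v} | v. v \<in> verts H'} \<union> {{b, t}, {t, s}})"

lemma scorpion_iso:
  assumes "graph_iso G H" "scorpion G"
  shows "scorpion H"
proof -
  obtain f where f: "bij_betw f (verts G) (verts H)" and E: "edges H = (\<lambda>e. f ` e) ` edges G"
    using assms(1) unfolding graph_iso_def by blast
  obtain G' b t s where g: "simple_graph G'" "card (verts G') \<ge> 2"
      "b \<notin> verts G'" "t \<notin> verts G'" "s \<notin> verts G'" "distinct [b, t, s]"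
    and V: "verts G = verts G' \<union> {b, t, s}"
    and EG: "edges G = edges G' \<union> {{b, v} | v. v \<in> verts G'} \<union> {{b, t}, {t, s}}"
    using assms(2) unfolding scorpion_def by (elim exE conjE) (rule that)
  have inj: "inj_on f (verts G' \<union> {b, t, s})"
    using f V by (simp add: bij_betw_def)
  let ?H' = "Graph (f ` verts G') ((\<lambda>e. f ` e) ` edges G')"
  have injG': "inj_on f (verts G')" using inj by (rule inj_on_subset) blast
  have 1: "simple_graph ?H'"
    unfolding simple_graph_def
  proof (intro conjI ballI)
    show "finite (verts ?H')" using g(1) by (simp add: simple_graph_def)
    fix e assume "e \<in> edges ?H'"
    then obtain d where d: "e = f ` d" "d \<in> edges G'" by auto
    then have "d \<subseteq> verts G'" "card d = 2" using g(1) by (auto simp: simple_graph_def)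
    then show "e \<subseteq> verts ?H'" "card e = 2"
      using d(1) inj_on_subset[OF injG'] by (auto simp: card_image)
  qed
  have 2: "card (verts ?H') \<ge> 2" using g(2) injG' by (simp add: card_image)
  have 3: "f b \<notin> verts ?H'" "f t \<notin> verts ?H'" "f s \<notin> verts ?H'" "distinct [f b, f t, f s]"
    using inj g(3-6) by (auto simp: inj_on_def)
  have 4: "verts H = verts ?H' \<union> {f b, f t, f s}"
    using f V by (auto simp: bij_betw_def)
  have 5: "edges H = edges ?H' \<union> {{f b, v} | v. v \<in> verts ?H'} \<union> {{f b, f t}, {f t, f s}}"
  proof -
    have *: "{{x, v} | v. v \<in> A} = (\<lambda>v. {x, v}) ` A" for x :: 'c and A by blast
    show ?thesis unfolding E EG * by (simp add: image_Un image_image)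
  qed
  show ?thesis unfolding scorpion_def
    by (intro exI[of _ ?H'] exI[of _ "f b"] exI[of _ "f t"] exI[of _ "f s"] conjI) (fact 1 2 3 4 5)+
qed

lemma graph_iso_sym:
  assumes "graph_iso G H" "simple_graph G"
  shows "graph_iso H G"
proof -
  obtain f where f: "bij_betw f (verts G) (verts H)" and E: "edges H = (\<lambda>e. f ` e) ` edges G"
    using assms(1) unfolding graph_iso_def by blast
  let ?g = "inv_into (verts G) f"
  have "?g ` f ` e = e" if "e \<in> edges G" for e
    using that assms(2) f unfolding simple_graph_def bij_betw_def
    by simp
  then have "edges G = (\<lambda>e. ?g ` e) ` edges H"
    unfolding E image_image by simp
  then show ?thesis
    unfolding graph_iso_def using bij_betw_inv_into[OF f] by blast
qed

lemma graph_property_scorpion: "graph_property scorpion"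
  unfolding graph_property_def using scorpion_iso graph_iso_sym by fast

section \<open>Word RAM\<close>

text \<open>A state consists of registers and of memory cells, all holding \<open>w\<close>-bit words. Only memory is
  randomly addressable; a program touches the fixed, finite set of registers it names.
  Every operation, memory access and test takes one time unit, and arithmetic is modulo
  \<open>2 ^ w\<close>. Programs are written with structured control flow instead of jumps, which changes
  running times by at most a constant factor.\<close>

type_synonym state = "(nat \<Rightarrow> nat) \<times> (nat \<Rightarrow> nat)"

datatype operand = Const nat | Reg nat

datatype binop = Add | Sub | Mul

datatype test = Less operand operand | Equal operand operand

datatype com =
    Skip
  | Op nat binop operand operand
  | Load nat operand
  | Store operand operand
  | Seq com com
  | If test com com
  | While test com

fun operand_val :: "nat \<Rightarrow> (nat \<Rightarrow> nat) \<Rightarrow> operand \<Rightarrow> nat" where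
  "operand_val w r (Const c) = c mod 2 ^ w"
| "operand_val w r (Reg i) = r i"

fun binop_val :: "nat \<Rightarrow> binop \<Rightarrow> nat \<Rightarrow> nat \<Rightarrow> nat" where
  "binop_val w Add x y = (x + y) mod 2 ^ w"
| "binop_val w Sub x y = nat ((int x - int y) mod 2 ^ w)"
| "binop_val w Mul x y = (x * y) mod 2 ^ w"

fun test_val :: "nat \<Rightarrow> (nat \<Rightarrow> nat) \<Rightarrow> test \<Rightarrow> bool" where
  "test_val w r (Less x y) \<longleftrightarrow> operand_val w r x < operand_val w r y"
| "test_val w r (Equal x y) \<longleftrightarrow> operand_val w r x = operand_val w r y"

text \<open>\<open>exec w c \<sigma> t \<sigma>'\<close>: with word size \<open>w\<close>, program \<open>c\<close> started in \<open>\<sigma>\<close> halts after exactly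
  \<open>t\<close> steps in \<open>\<sigma>'\<close>.\<close>

inductive exec :: "nat \<Rightarrow> com \<Rightarrow> state \<Rightarrow> nat \<Rightarrow> state \<Rightarrow> bool" for w :: nat where
  Skip: "exec w Skip \<sigma> 1 \<sigma>"
| Op: "exec w (Op i f x y) (r, m) 1
         (r(i := binop_val w f (operand_val w r x) (operand_val w r y)), m)"
| Load: "exec w (Load i x) (r, m) 1 (r(i := m (operand_val w r x)), m)"
| Store: "exec w (Store x y) (r, m) 1 (r, m(operand_val w r x := operand_val w r y))"
| Seq: "exec w c1 \<sigma>1 t1 \<sigma>2 \<Longrightarrow> exec w c2 \<sigma>2 t2 \<sigma>3 \<Longrightarrow> exec w (Seq c1 c2) \<sigma>1 (t1 + t2) \<sigma>3"
| IfTrue: "test_val w (fst \<sigma>) b \<Longrightarrow> exec w c1 \<sigma> t \<sigma>' \<Longrightarrow> exec w (If b c1 c2) \<sigma> (1 + t) \<sigma>'"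
| IfFalse: "\<not> test_val w (fst \<sigma>) b \<Longrightarrow> exec w c2 \<sigma> t \<sigma>' \<Longrightarrow> exec w (If b c1 c2) \<sigma> (1 + t) \<sigma>'"
| WhileFalse: "\<not> test_val w (fst \<sigma>) b \<Longrightarrow> exec w (While b c) \<sigma> 1 \<sigma>"
| WhileTrue: "test_val w (fst \<sigma>1) b \<Longrightarrow> exec w c \<sigma>1 t1 \<sigma>2 \<Longrightarrow> exec w (While b c) \<sigma>2 t2 \<sigma>3
     \<Longrightarrow> exec w (While b c) \<sigma>1 (1 + t1 + t2) \<sigma>3"

section \<open>Counting induced subgraphs\<close>

text \<open>Input: a graph on the vertices \<open>0, \<dots>, n - 1\<close> as a row-major adjacency matrix starting
  at memory cell 0, with \<open>n\<close> and \<open>k\<close> in the first two registers and zeros elsewhere.\<close>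

definition input_state :: "nat \<Rightarrow> nat \<Rightarrow> nat graph \<Rightarrow> state" where
  "input_state n k G =
     ((\<lambda>_. 0)(0 := n, 1 := k),
      \<lambda>i. if i < n * n \<and> {i div n, i mod n} \<in> edges G then 1 else 0)"

text \<open>Output: the count can be exponential in \<open>n\<close> and need not fit in a word. It is returned in
  binary, one bit per cell and least significant bit first; register 0 points to the first bit and
  register 1 holds the number of bits.\<close>

definition output_is :: "state \<Rightarrow> nat \<Rightarrow> bool" where
  "output_is \<sigma> N \<longleftrightarrow>
     (case \<sigma> of (r, m) \<Rightarrow>
        (\<forall>i<r 1. m (r 0 + i) \<in> {0, 1}) \<and> N = (\<Sum>i<r 1. m (r 0 + i) * 2 ^ i))"

definition indsub_count :: "(nat graph \<Rightarrow> bool) \<Rightarrow> nat \<Rightarrow> nat graph \<Rightarrow> nat" where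
  "indsub_count \<Phi> k G = card {X. X \<subseteq> verts G \<and> card X = k \<and> \<Phi> (induced G X)}"

text \<open>The word size is logarithmic in the numbers \<open>n\<close> and \<open>k\<close>, i.e. any \<open>w\<close> of at least
  \<open>d * log 2 (n + k + 2)\<close> is allowed for some constant \<open>d\<close>. The time bound depends on \<open>n\<close> only.\<close>

definition indsub_solvable_in_time :: "(nat graph \<Rightarrow> bool) \<Rightarrow> (nat \<Rightarrow> nat) \<Rightarrow> bool" where
  "indsub_solvable_in_time \<Phi> T \<longleftrightarrow>
     (\<exists>P d. d > 0 \<and>
        (\<forall>n k G w. simple_graph G \<longrightarrow> verts G = {..<n} \<longrightarrow> (n + k + 2) ^ d \<le> 2 ^ w \<longrightarrow>
           (\<exists>t \<sigma>. exec w P (input_state n k G) t \<sigma> \<and> t \<le> T n \<and>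
                  output_is \<sigma> (indsub_count \<Phi> k G))))"

end

(* In a scorpion the vertices b, t, s are determined by the graph. So the k-vertex induced
   scorpions correspond to the triples (b, t, s) with edges bt, ts and non-edge bs together with
   k - 3 of the c(b, t, s) vertices that are adjacent to b but to neither t nor s, and their number
   is the sum over these triples of the binomial coefficients (c(b, t, s) choose (k - 3)).
   There are at most n^3 triples; for each of them c(b, t, s) is computed in O(n) steps and one
   tabulated binomial coefficient of n bits is added to the total in O(n) steps. The total is
   less than 2^n, so all numbers may be kept modulo 2^n. *)

theory Submission
  imports Defs
begin

section \<open>Counting scorpions by their tails\<close>

text \<open>Counts may need n bits while a word may hold only logarithmically many, so every
  addition of counts costs a factor n. With n^3 triples this is affordable only if no triple has to
  compute a binomial coefficient: the table has n^2 entries, each obtained by Pascal's rule with two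
  additions, hence O(n^3) steps in all. The time bound may not depend on \<open>k\<close>, so
  \<open>k < 5\<close> and \<open>k > n\<close> are answered at once with 0; otherwise
  \<open>k - 3\<close> is a positive row index below n. The program never tests whether a triple is
  a tail: the conditions become 0/1 factors of a weight, and weight 0 selects a table entry that is
  itself 0. The additions are verified for unbounded ghost values of which memory shows the low n
  bits, so dropped carries need no separate treatment, and the bound by 2^n enters once, when the
  output is read.\<close>

definition is_tail :: "'a graph \<Rightarrow> 'a \<Rightarrow> 'a \<Rightarrow> 'a \<Rightarrow> bool" where
  "is_tail G b t s \<longleftrightarrow> {b, t} \<in> edges G \<and> {t, s} \<in> edges G \<and> {b, s} \<notin> edges G \<and> b \<noteq> s"

definition candidates :: "'a graph \<Rightarrow> 'a \<Rightarrow> 'a \<Rightarrow> 'a \<Rightarrow> 'a set" where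
  "candidates G b t s = {v \<in> verts G. {b, v} \<in> edges G \<and> {t, v} \<notin> edges G \<and> {s, v} \<notin> edges G}"

lemma simple_graph_edgeD:
  assumes "simple_graph G" "{x, y} \<in> edges G"
  shows "x \<noteq> y" "x \<in> verts G" "y \<in> verts G"
  using assms by (auto simp: simple_graph_def)

lemma finite_candidates: "simple_graph G \<Longrightarrow> finite (candidates G b t s)"
  by (simp add: simple_graph_def candidates_def)

text \<open>The candidates avoid the tail without being told to: \<open>b\<close> would need a loop,
  \<open>t\<close> is excluded by the edge \<open>{t, s}\<close>, and \<open>s\<close> by the
  non-edge \<open>{b, s}\<close>.\<close>

lemma tail_not_candidate:
  assumes "simple_graph G" "is_tail G b t s"
  shows "b \<noteq> t" "t \<noteq> s" "b \<noteq> s"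
    "b \<notin> candidates G b t s" "t \<notin> candidates G b t s" "s \<notin> candidates G b t s"
  using assms simple_graph_edgeD(1)[OF assms(1)]
  by (auto simp: is_tail_def candidates_def insert_commute)

text \<open>The graph below \<open>b\<close> is arbitrary, so edges inside \<open>Y\<close> are
  unconstrained and \<open>Y\<close> can be any set of at least two candidates.\<close>

lemma scorpion_induced_iff:
  assumes G: "simple_graph G" and X: "X \<subseteq> verts G"
  shows "scorpion (induced G X) \<longleftrightarrow>
    (\<exists>b t s Y. is_tail G b t s \<and> Y \<subseteq> candidates G b t s \<and> 2 \<le> card Y \<and> X = Y \<union> {b, t, s})"
proof
  assume "scorpion (induced G X)"
  then obtain H b t s where H: "simple_graph H" "card (verts H) \<ge> 2"
      "b \<notin> verts H" "t \<notin> verts H" "s \<notin> verts H" "distinct [b, t, s]"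
    and V: "X = verts H \<union> {b, t, s}"
    and E: "{e \<in> edges G. e \<subseteq> X} = edges H \<union> {{b, v} | v. v \<in> verts H} \<union> {{b, t}, {t, s}}"
    unfolding scorpion_def induced_def by auto
  have E': "e \<in> edges G \<longleftrightarrow> e \<in> edges H \<or> (\<exists>v\<in>verts H. e = {b, v}) \<or> e = {b, t} \<or> e = {t, s}"
    if "e \<subseteq> X" for e
    using that E by blast
  have sub: "e \<subseteq> verts H" if "e \<in> edges H" for e
    using H(1) that by (simp add: simple_graph_def)
  have "is_tail G b t s"
    unfolding is_tail_def using H V sub by (auto simp: E' doubleton_eq_iff)
  moreover have "verts H \<subseteq> candidates G b t s"
  proof
    fix v assume v: "v \<in> verts H"
    then show "v \<in> candidates G b t s"
      unfolding candidates_def using H V X sub by (auto simp: E' doubleton_eq_iff)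
  qed
  ultimately show "\<exists>b t s Y. is_tail G b t s \<and> Y \<subseteq> candidates G b t s \<and> 2 \<le> card Y \<and> X = Y \<union> {b, t, s}"
    using H(2) V by blast
next
  assume "\<exists>b t s Y. is_tail G b t s \<and> Y \<subseteq> candidates G b t s \<and> 2 \<le> card Y \<and> X = Y \<union> {b, t, s}"
  then obtain b t s Y where T: "is_tail G b t s" and Y: "Y \<subseteq> candidates G b t s" "2 \<le> card Y"
    and XY: "X = Y \<union> {b, t, s}" by blast
  note tn = tail_not_candidate[OF G T]
  have "simple_graph (induced G Y)"
    using G Y(1) by (auto simp: simple_graph_def induced_def candidates_def intro: finite_subset)
  moreover have "{e \<in> edges G. e \<subseteq> X} =
      {e \<in> edges G. e \<subseteq> Y} \<union> {{b, v} | v. v \<in> Y} \<union> {{b, t}, {t, s}}" (is "?L = ?R")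
  proof
    show "?L \<subseteq> ?R"
    proof
      fix e assume e: "e \<in> ?L"
      then have "card e = 2" using G by (simp add: simple_graph_def)
      then obtain x y where xy: "e = {x, y}" "x \<noteq> y" by (meson card_2_iff)
      have "{x, y} \<in> edges G" "x \<in> X" "y \<in> X" "{y, x} \<in> edges G"
        using e xy by (auto simp: insert_commute)
      then show "e \<in> ?R"
        using T Y(1) xy(2) unfolding XY xy(1) is_tail_def candidates_def
        by (auto simp: insert_commute)
    qed
    show "?R \<subseteq> ?L"
      using T Y(1) unfolding XY is_tail_def candidates_def by auto
  qed
  moreover have "b \<notin> Y" "t \<notin> Y" "s \<notin> Y" "distinct [b, t, s]"
    using tn Y(1) by auto
  ultimately show "scorpion (induced G X)"
    unfolding scorpion_def induced_def using Y(2) XY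
    by (intro exI[of _ "Graph Y {e \<in> edges G. e \<subseteq> Y}"] exI[of _ b] exI[of _ t] exI[of _ s] conjI)
      (simp_all only: graph.sel simp_thms)
qed

text \<open>In a scorpion, \<open>b\<close> is the only vertex with at most one non-neighbour, \<open>s\<close> is that
  non-neighbour, and \<open>t\<close> is the only neighbour of \<open>s\<close>.\<close>

lemma tail_unique:
  assumes G: "simple_graph G"
    and T: "is_tail G b t s" "Y \<subseteq> candidates G b t s" "2 \<le> card Y"
    and T': "is_tail G b' t' s'" "Y' \<subseteq> candidates G b' t' s'" "2 \<le> card Y'"
    and X: "Y \<union> {b, t, s} = Y' \<union> {b', t', s'}"
  shows "b = b' \<and> t = t' \<and> s = s' \<and> Y = Y'"
proof -
  note tn = tail_not_candidate[OF G T(1)] and tn' = tail_not_candidate[OF G T'(1)]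
  obtain y z where yz: "y \<in> Y" "z \<in> Y" "y \<noteq> z"
    using T(3) by (metis card_le_Suc0_iff_eq card.infinite not_less_eq_eq numeral_2_eq_2 zero_le)
  have adj: "{b', x} \<in> edges G" if "x \<in> Y \<union> {b, t, s}" "x \<noteq> b'" "x \<noteq> s'" for x
    using that T' unfolding X by (auto simp: is_tail_def candidates_def)
  have nonadj: "{y, t} \<notin> edges G" "{y, s} \<notin> edges G" "y \<noteq> t" "y \<noteq> s" if "y \<in> Y" for y
    using that T(2) tn by (auto simp: candidates_def insert_commute)
  \<comment> \<open>Inside the common vertex set, \<open>b'\<close> misses only \<open>s'\<close>.
    An element of \<open>Y\<close> misses both \<open>t\<close> and \<open>s\<close>, so it cannot
    be \<open>b'\<close>.\<close>
  have "b' \<notin> Y"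
    using adj[of t] adj[of s] nonadj[of b'] tn(2) by blast
  \<comment> \<open>Here two elements of \<open>Y\<close> are needed: \<open>t\<close>, and likewise
    \<open>s\<close>, misses both \<open>y\<close> and \<open>z\<close>.\<close>
  moreover have "b' \<noteq> t"
    using adj[of y] adj[of z] nonadj(1,3)[of y] nonadj(1,3)[of z] yz
    by (metis UnCI insert_commute)
  moreover have "b' \<noteq> s"
    using adj[of y] adj[of z] nonadj(2,4)[of y] nonadj(2,4)[of z] yz
    by (metis UnCI insert_commute)
  moreover have "b' \<in> Y \<union> {b, t, s}" using X by blast
  ultimately have b: "b = b'" by blast
  have "{b', s'} \<notin> edges G" "s' \<in> Y \<union> {b, t, s}" "s' \<noteq> b'"
    using T' tn' X by (auto simp: is_tail_def)
  then have s: "s = s'"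
    using T(1,2) b by (auto simp: is_tail_def candidates_def)
  have "{t', s} \<in> edges G" "t' \<in> Y \<union> {b, t, s}" "t' \<noteq> b" "t' \<noteq> s"
    using T'(1) s b tn' X by (auto simp: is_tail_def)
  then have t: "t = t'"
    using nonadj(2) by blast
  have "Y = (Y \<union> {b, t, s}) - {b, t, s}" using T(2) tn by auto
  also have "\<dots> = (Y' \<union> {b', t', s'}) - {b', t', s'}" using X unfolding b s t by simp
  also have "\<dots> = Y'" using T'(2) tn' by auto
  finally show ?thesis using b s t by blast
qed

text \<open>The map sending a tail and a set \<open>Y\<close> of candidates to their union is a
  bijection onto the counted sets. Injectivity is \<open>tail_unique\<close>, whose requirement
  \<open>2 \<le> card Y\<close> is what \<open>5 \<le> k\<close> provides.\<close>

lemma indsub_count_scorpion: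
  assumes G: "simple_graph G" and k: "5 \<le> k"
  shows "indsub_count scorpion k G =
    (\<Sum>(b, t, s) | is_tail G b t s. card (candidates G b t s) choose (k - 3))"
proof -
  let ?D = "{(b, t, s). is_tail G b t s}"
  let ?S = "SIGMA d : ?D. {Y. Y \<subseteq> (case d of (b, t, s) \<Rightarrow> candidates G b t s) \<and> card Y = k - 3}"
  let ?f = "\<lambda>((b, t, s), Y). Y \<union> {b, t, s}"
  have fin: "finite (verts G)" using G by (simp add: simple_graph_def)
  have "?D \<subseteq> verts G \<times> verts G \<times> verts G"
    using simple_graph_edgeD[OF G] by (auto simp: is_tail_def)
  then have finD: "finite ?D" using fin by (meson finite_SigmaI finite_subset)
  have inj: "inj_on ?f ?S"
  proof (rule inj_onI)
    fix p q assume "p \<in> ?S" "q \<in> ?S" "?f p = ?f q"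
    moreover obtain b t s Y where "p = ((b, t, s), Y)" by (metis prod.exhaust)
    moreover obtain b' t' s' Y' where "q = ((b', t', s'), Y')" by (metis prod.exhaust)
    ultimately show "p = q"
      using tail_unique[OF G, of b t s Y b' t' s' Y'] k by simp
  qed
  have card_X: "card (Y \<union> {b, t, s}) = card Y + 3"
    if "is_tail G b t s" "Y \<subseteq> candidates G b t s" for b t s Y
  proof -
    note tn = tail_not_candidate[OF G that(1)]
    have "card (Y \<union> {b, t, s}) = card Y + card {b, t, s}"
      using that(2) tn finite_subset[OF that(2) finite_candidates[OF G]]
      by (intro card_Un_disjoint) auto
    then show ?thesis using tn by simp
  qed
  have "{X. X \<subseteq> verts G \<and> card X = k \<and> scorpion (induced G X)} = ?f ` ?S"
  proof (intro set_eqI iffI)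
    fix X assume "X \<in> {X. X \<subseteq> verts G \<and> card X = k \<and> scorpion (induced G X)}"
    then have X: "X \<subseteq> verts G" "card X = k" "scorpion (induced G X)" by simp_all
    obtain b t s Y where T: "is_tail G b t s" "Y \<subseteq> candidates G b t s" "X = Y \<union> {b, t, s}"
      using X(3) unfolding scorpion_induced_iff[OF G X(1)] by blast
    then have "card Y = k - 3" using card_X[OF T(1,2)] X(2) by simp
    then show "X \<in> ?f ` ?S"
      using T by (intro image_eqI[of _ _ "((b, t, s), Y)"]) auto
  next
    fix X assume "X \<in> ?f ` ?S"
    then obtain b t s Y where T: "is_tail G b t s" "Y \<subseteq> candidates G b t s" "card Y = k - 3"
      and X: "X = Y \<union> {b, t, s}" by auto
    have sub: "X \<subseteq> verts G"
      using T X simple_graph_edgeD[OF G] by (auto simp: is_tail_def candidates_def)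
    moreover have "card X = k" using card_X[OF T(1,2)] T(3) X k by simp
    moreover have "scorpion (induced G X)"
      unfolding scorpion_induced_iff[OF G sub] using T X k
      by (intro exI[of _ b] exI[of _ t] exI[of _ s] exI[of _ Y]) simp
    ultimately show "X \<in> {X. X \<subseteq> verts G \<and> card X = k \<and> scorpion (induced G X)}" by simp
  qed
  then have "indsub_count scorpion k G = card ?S"
    unfolding indsub_count_def using card_image[OF inj] by simp
  also have "\<dots> = (\<Sum>d\<in>?D. card {Y. Y \<subseteq> (case d of (b, t, s) \<Rightarrow> candidates G b t s) \<and> card Y = k - 3})"
    by (rule card_SigmaI[OF finD]) (use finite_candidates[OF G] in auto)
  also have "\<dots> = (\<Sum>(b, t, s) | is_tail G b t s. card (candidates G b t s) choose (k - 3))"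
    using finite_candidates[OF G] by (intro sum.cong) (auto simp: n_subsets)
  finally show ?thesis .
qed

lemma scorpion_card_ge:
  assumes "scorpion H" shows "5 \<le> card (verts H)"
proof -
  obtain H' b t s where *: "simple_graph H'" "card (verts H') \<ge> 2"
      "b \<notin> verts H'" "t \<notin> verts H'" "s \<notin> verts H'" "distinct [b, t, s]"
      "verts H = verts H' \<union> {b, t, s}"
    using assms unfolding scorpion_def by (elim exE conjE) (rule that)
  have "card (verts H) = card (verts H') + card {b, t, s}"
    unfolding *(7) using * by (intro card_Un_disjoint) (auto simp: simple_graph_def)
  then show ?thesis using * by simp
qed

text \<open>These are the cases decided without touching the graph. The second one also keeps the
  running time independent of \<open>k\<close>.\<close>

lemma indsub_count_eq_0:
  assumes "finite (verts G)" "k < 5 \<or> card (verts G) < k"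
  shows "indsub_count scorpion k G = 0"
proof -
  have "\<not> scorpion (induced G X)" if "X \<subseteq> verts G" "card X = k" for X
    using scorpion_card_ge[of "induced G X"] card_mono[OF assms(1) that(1)] that(2) assms(2)
    by (auto simp: induced_def)
  then have "{X. X \<subseteq> verts G \<and> card X = k \<and> scorpion (induced G X)} = {}" by blast
  then show ?thesis by (simp only: indsub_count_def card.empty)
qed

text \<open>The empty set has the wrong size, which makes the bound strict, so one bit per vertex
  suffices for the output.\<close>

lemma indsub_count_less:
  assumes "finite (verts G)" "0 < k"
  shows "indsub_count \<Phi> k G < 2 ^ card (verts G)"
proof -
  have "{X. X \<subseteq> verts G \<and> card X = k \<and> \<Phi> (induced G X)} \<subseteq> Pow (verts G) - {{}}"
    using assms(2) by auto
  then have "{X. X \<subseteq> verts G \<and> card X = k \<and> \<Phi> (induced G X)} \<subset> Pow (verts G)" by blast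
  then have "card {X. X \<subseteq> verts G \<and> card X = k \<and> \<Phi> (induced G X)} < card (Pow (verts G))"
    using assms(1) by (intro psubset_card_mono) auto
  then show ?thesis using assms by (simp add: indsub_count_def card_Pow)
qed

section \<open>Tails and candidates as 0/1 arithmetic\<close>

definition adj :: "'a graph \<Rightarrow> 'a \<Rightarrow> 'a \<Rightarrow> nat" where
  "adj G u v = of_bool ({u, v} \<in> edges G)"

text \<open>Conjunction is written as a product and negation as \<open>1 - x\<close>, so the machine
  evaluates the weight with \<open>Sub\<close> and \<open>Mul\<close> alone. The intended value is
  the number of candidates for a tail and 0 for any other triple.\<close>

definition tail_weight :: "(nat \<Rightarrow> nat \<Rightarrow> nat) \<Rightarrow> nat \<Rightarrow> nat \<Rightarrow> nat \<Rightarrow> nat \<Rightarrow> nat" where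
  "tail_weight A n b t s =
     (\<Sum>v<n. A b v * (1 - A t v) * (1 - A s v)) * A b t * A t s * (1 - A b s)"

text \<open>A triple that is not a tail has weight 0 and contributes \<open>0 choose (k - 3) = 0\<close>. This
  covers \<open>b = s\<close> as well, since then every summand of the weight vanishes.\<close>

lemma indsub_count_scorpion_weight:
  assumes G: "simple_graph G" and V: "verts G = {..<n}" and k: "5 \<le> k"
  shows "indsub_count scorpion k G =
    (\<Sum>b<n. \<Sum>t<n. \<Sum>s<n. tail_weight (adj G) n b t s choose (k - 3))"
proof -
  have cand: "(\<Sum>v<n. adj G b v * (1 - adj G t v) * (1 - adj G s v)) = card (candidates G b t s)" for b t s
  proof -
    have "(\<Sum>v<n. adj G b v * (1 - adj G t v) * (1 - adj G s v)) =
        (\<Sum>v<n. of_bool ({b, v} \<in> edges G \<and> {t, v} \<notin> edges G \<and> {s, v} \<notin> edges G))"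
      by (intro sum.cong) (auto simp: adj_def)
    also have "\<dots> = card (candidates G b t s)"
      by (simp add: candidates_def V Int_def)
    finally show ?thesis .
  qed
  have w: "tail_weight (adj G) n b t s = (if is_tail G b t s then card (candidates G b t s) else 0)" for b t s
  proof (cases "b = s")
    case True
    then have "tail_weight (adj G) n b t s = 0"
      by (auto simp: tail_weight_def adj_def)
    then show ?thesis using True by (simp add: is_tail_def)
  next
    case False
    then show ?thesis
      unfolding tail_weight_def cand by (simp add: is_tail_def adj_def)
  qed
  let ?D = "{(b, t, s). is_tail G b t s}"
  have D: "?D \<subseteq> {..<n} \<times> {..<n} \<times> {..<n}"
    using simple_graph_edgeD[OF G] unfolding V by (auto simp: is_tail_def)
  have "indsub_count scorpion k G =
      (\<Sum>(b, t, s)\<in>?D. tail_weight (adj G) n b t s choose (k - 3))"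
    unfolding indsub_count_scorpion[OF G k] by (intro sum.cong) (auto simp: w)
  also have "\<dots> = (\<Sum>(b, t, s)\<in>{..<n} \<times> {..<n} \<times> {..<n}. tail_weight (adj G) n b t s choose (k - 3))"
    using D k by (intro sum.mono_neutral_left) (auto simp: w binomial_eq_0)
  also have "\<dots> = (\<Sum>b<n. \<Sum>t<n. \<Sum>s<n. tail_weight (adj G) n b t s choose (k - 3))"
    by (simp add: sum.cartesian_product)
  finally show ?thesis .
qed

section \<open>Nontriviality at every size from 5 on\<close>

lemma not_meager_scorpion: "\<not> meager scorpion"
proof -
  \<comment> \<open>The scorpion over an edgeless graph with \<open>l + 2\<close> vertices is
    compared with the edgeless graph of the same order.\<close>
  have "\<not> trivial_at scorpion (l + 5)" for l
  proof -
    let ?V = "{..<l + 2}"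
    let ?H = "Graph ?V {} :: nat graph"
    let ?S = "Graph (?V \<union> {l + 2, l + 3, l + 4})
      ({} \<union> {{l + 2, v} | v. v \<in> ?V} \<union> {{l + 2, l + 3}, {l + 3, l + 4}})"
    let ?E = "Graph {..<l + 5} {} :: nat graph"
    have V: "?V \<union> {l + 2, l + 3, l + 4} = {..<l + 5}" by auto
    have "scorpion ?S"
      unfolding scorpion_def
      by (intro exI[of _ ?H] exI[of _ "l + 2"] exI[of _ "l + 3"] exI[of _ "l + 4"])
        (auto simp: simple_graph_def)
    moreover have "simple_graph ?S" "card (verts ?S) = l + 5"
      unfolding simple_graph_def graph.sel V by (auto simp: card_insert_if)
    ultimately have "\<exists>G. simple_graph G \<and> card (verts G) = l + 5 \<and> scorpion (G :: nat graph)" by blast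
    moreover have "\<not> scorpion ?E" by (simp add: scorpion_def)
    moreover have "simple_graph ?E" "card (verts ?E) = l + 5" by (simp_all add: simple_graph_def)
    ultimately show ?thesis unfolding trivial_at_def by blast
  qed
  then have "range (\<lambda>l. l + 5) \<subseteq> {k. \<not> trivial_at scorpion k}" by blast
  moreover have "infinite (range (\<lambda>l::nat. l + 5))"
    by (auto dest!: finite_imageD simp: inj_on_def)
  ultimately show ?thesis unfolding meager_def using finite_subset by blast
qed

section \<open>Time-bounded Hoare triples\<close>

definition triple ::
  "nat \<Rightarrow> ((nat \<Rightarrow> nat) \<Rightarrow> (nat \<Rightarrow> nat) \<Rightarrow> bool) \<Rightarrow> com \<Rightarrow> nat \<Rightarrow>
    ((nat \<Rightarrow> nat) \<Rightarrow> (nat \<Rightarrow> nat) \<Rightarrow> bool) \<Rightarrow> bool" where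
  "triple w P c T Q \<longleftrightarrow>
     (\<forall>r m. P r m \<longrightarrow> (\<exists>t r' m'. exec w c (r, m) t (r', m') \<and> t \<le> T \<and> Q r' m'))"

lemma tripleD:
  assumes "triple w P c T Q" "P r m"
  obtains t r' m' where "exec w c (r, m) t (r', m')" "t \<le> T" "Q r' m'"
  using assms unfolding triple_def by blast

lemma triple_conseq:
  assumes "triple w P c T Q"
    and "\<And>r m. P' r m \<Longrightarrow> P r m" "\<And>r m. Q r m \<Longrightarrow> Q' r m" "T \<le> T'"
  shows "triple w P' c T' Q'"
  using assms unfolding triple_def by (meson le_trans)

lemma triple_Seq:
  assumes "triple w P c1 T1 Q" "triple w Q c2 T2 R"
  shows "triple w P (Seq c1 c2) (T1 + T2) R"
  unfolding triple_def
proof (intro allI impI)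
  fix r m assume "P r m"
  then obtain t1 r1 m1 where 1: "exec w c1 (r, m) t1 (r1, m1)" "t1 \<le> T1" "Q r1 m1"
    by (rule tripleD[OF assms(1)])
  then obtain t2 r2 m2 where 2: "exec w c2 (r1, m1) t2 (r2, m2)" "t2 \<le> T2" "R r2 m2"
    by (elim tripleD[OF assms(2)])
  show "\<exists>t r' m'. exec w (Seq c1 c2) (r, m) t (r', m') \<and> t \<le> T1 + T2 \<and> R r' m'"
    using exec.Seq[OF 1(1) 2(1)] 1(2) 2(2,3) by (meson add_le_mono)
qed

lemma triple_If:
  assumes "triple w (\<lambda>r m. P r m \<and> test_val w r b) c1 T Q"
    and "triple w (\<lambda>r m. P r m \<and> \<not> test_val w r b) c2 T Q"
  shows "triple w P (If b c1 c2) (1 + T) Q"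
  unfolding triple_def
proof (intro allI impI)
  fix r m assume P: "P r m"
  show "\<exists>t r' m'. exec w (If b c1 c2) (r, m) t (r', m') \<and> t \<le> 1 + T \<and> Q r' m'"
  proof (cases "test_val w r b")
    case True
    then obtain t r' m' where "exec w c1 (r, m) t (r', m')" "t \<le> T" "Q r' m'"
      using P tripleD[OF assms(1)] by blast
    then show ?thesis using True exec.IfTrue[of w "(r, m)"] by (metis add_left_mono fst_conv)
  next
    case False
    then obtain t r' m' where "exec w c2 (r, m) t (r', m')" "t \<le> T" "Q r' m'"
      using P tripleD[OF assms(2)] by blast
    then show ?thesis using False exec.IfFalse[of w "(r, m)"] by (metis add_left_mono fst_conv)
  qed
qed

section \<open>Symbolic execution of loop-free code\<close>

fun straight :: "com \<Rightarrow> bool" where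
  "straight (Seq c1 c2) \<longleftrightarrow> straight c1 \<and> straight c2"
| "straight (If b c1 c2) \<longleftrightarrow> straight c1 \<and> straight c2"
| "straight (While b c) \<longleftrightarrow> False"
| "straight _ \<longleftrightarrow> True"

fun cost :: "com \<Rightarrow> nat" where
  "cost (Seq c1 c2) = cost c1 + cost c2"
| "cost (If b c1 c2) = 1 + max (cost c1) (cost c2)"
| "cost _ = 1"

text \<open>An executable semantics, so that a triple for loop-free code becomes a goal for the
  simplifier. The last equation gives loops a dummy value; \<open>exec_run\<close> excludes them by
  \<open>straight\<close>.\<close>

fun run :: "nat \<Rightarrow> com \<Rightarrow> state \<Rightarrow> state" where
  "run w (Op i f x y) (r, m) = (r(i := binop_val w f (operand_val w r x) (operand_val w r y)), m)"
| "run w (Load i x) (r, m) = (r(i := m (operand_val w r x)), m)"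
| "run w (Store x y) (r, m) = (r, m(operand_val w r x := operand_val w r y))"
| "run w (Seq c1 c2) (r, m) = run w c2 (run w c1 (r, m))"
| "run w (If b c1 c2) (r, m) = (if test_val w r b then run w c1 (r, m) else run w c2 (r, m))"
| "run w _ \<sigma> = \<sigma>"

lemma exec_run: "straight c \<Longrightarrow> \<exists>t\<le>cost c. exec w c \<sigma> t (run w c \<sigma>)"
proof (induction c arbitrary: \<sigma>)
  case (Seq c1 c2)
  obtain t1 where "t1 \<le> cost c1" "exec w c1 \<sigma> t1 (run w c1 \<sigma>)"
    using Seq.IH(1)[of \<sigma>] Seq.prems by auto
  moreover obtain t2 where "t2 \<le> cost c2" "exec w c2 (run w c1 \<sigma>) t2 (run w c2 (run w c1 \<sigma>))"
    using Seq.IH(2)[of "run w c1 \<sigma>"] Seq.prems by auto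
  ultimately show ?case
    by (cases \<sigma>) (auto intro!: exI[of _ "t1 + t2"] exec.Seq)
next
  case (If b c1 c2)
  show ?case
  proof (cases "test_val w (fst \<sigma>) b")
    case True
    moreover obtain t where "t \<le> cost c1" "exec w c1 \<sigma> t (run w c1 \<sigma>)"
      using If.IH(1)[of \<sigma>] If.prems by auto
    ultimately show ?thesis
      using exec.IfTrue[of w \<sigma> b c1 t "run w c1 \<sigma>" c2] by (cases \<sigma>) (auto intro!: exI[of _ "1 + t"])
  next
    case False
    moreover obtain t where "t \<le> cost c2" "exec w c2 \<sigma> t (run w c2 \<sigma>)"
      using If.IH(2)[of \<sigma>] If.prems by auto
    ultimately show ?thesis
      using exec.IfFalse[of w \<sigma> b c2 t "run w c2 \<sigma>" c1] by (cases \<sigma>) (auto intro!: exI[of _ "1 + t"])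
  qed
next
  case Skip
  show ?case using exec.Skip[of w \<sigma>] by (cases \<sigma>) auto
next
  case (Op i f x y)
  show ?case using exec.Op[of w i f x y "fst \<sigma>" "snd \<sigma>"] by (cases \<sigma>) auto
next
  case (Load i x)
  show ?case using exec.Load[of w i x "fst \<sigma>" "snd \<sigma>"] by (cases \<sigma>) auto
next
  case (Store x y)
  show ?case using exec.Store[of w x y "fst \<sigma>" "snd \<sigma>"] by (cases \<sigma>) auto
qed simp

lemma triple_straight:
  assumes "straight c" "cost c \<le> T"
    and "\<And>r m. P r m \<Longrightarrow> case run w c (r, m) of (r', m') \<Rightarrow> Q r' m'"
  shows "triple w P c T Q"
  unfolding triple_def
proof (intro allI impI)
  fix r m assume "P r m"
  then show "\<exists>t r' m'. exec w c (r, m) t (r', m') \<and> t \<le> T \<and> Q r' m'"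
    using exec_run[OF assms(1), of w "(r, m)"] assms(2) assms(3)[of r m]
    by (cases "run w c (r, m)") (auto intro: le_trans)
qed

section \<open>Counting loops\<close>

definition For :: "nat \<Rightarrow> operand \<Rightarrow> com \<Rightarrow> com" where
  "For i b c = Seq (Op i Mul (Const 0) (Const 0))
     (While (Less (Reg i) b) (Seq c (Op i Add (Reg i) (Const 1))))"

text \<open>The invariant is indexed by the counter, and the body has to leave the counter
  unchanged. The limit \<open>b\<close> is reread in every round, hence the assumption
  \<open>bound\<close>. Each round adds a test and an increment to \<open>T\<close>; the summand 2
  pays for the reset and the final failing test.\<close>

lemma triple_For:
  assumes body: "\<And>x. x < N \<Longrightarrow> triple w (\<lambda>r m. I x r m \<and> r i = x) c T
      (\<lambda>r m. r i = x \<and> I (Suc x) (r(i := Suc x)) m)"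
    and bound: "\<And>x r m. I x r m \<Longrightarrow> operand_val w r b = N"
    and N: "N < 2 ^ w"
  shows "triple w (\<lambda>r m. I 0 (r(i := 0)) m) (For i b c) (2 + N * (T + 2)) (\<lambda>r m. I N r m)"
proof -
  let ?c = "Seq c (Op i Add (Reg i) (Const 1))"
  have loop: "\<exists>t r' m'. exec w (While (Less (Reg i) b) ?c) (r, m) t (r', m') \<and>
      t \<le> 1 + d * (T + 2) \<and> I N r' m'"
    if "x + d = N" "I x r m" "r i = x" for d x r m
    using that
  proof (induction d arbitrary: x r m)
    case 0
    then show ?case using bound[OF 0(2)] exec.WhileFalse[of w "(r, m)" "Less (Reg i) b" ?c]
      by auto
  next
    case (Suc d)
    have "x < N" using Suc.prems(1) by simp
    \<comment> \<open>Constants are reduced modulo \<open>2 ^ w\<close>, so \<open>Const 1\<close>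
      means 1 only for positive \<open>w\<close>.\<close>
    then have "0 < w" using N by (cases w) simp_all
    from body[OF \<open>x < N\<close>, unfolded triple_def, rule_format, of r m] Suc.prems(2,3)
    obtain t1 r1 m1 where 1: "exec w c (r, m) t1 (r1, m1)" "t1 \<le> T"
        "r1 i = x" "I (Suc x) (r1(i := Suc x)) m1" by blast
    have "binop_val w Add (operand_val w r1 (Reg i)) (operand_val w r1 (Const 1)) = Suc x"
      using N Suc.prems(1) 1(3) \<open>0 < w\<close> by (simp add: mod_simps)
    then have step: "exec w ?c (r, m) (t1 + 1) (r1(i := Suc x), m1)"
      using exec.Seq[OF 1(1) exec.Op[of w i Add "Reg i" "Const 1" r1 m1]] by simp
    have "Suc x + d = N" using Suc.prems(1) by simp
    from Suc.IH[OF this 1(4) fun_upd_same]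
    obtain t2 r2 m2 where 2: "exec w (While (Less (Reg i) b) ?c) (r1(i := Suc x), m1) t2 (r2, m2)"
        "t2 \<le> 1 + d * (T + 2)" "I N r2 m2" by blast
    have "test_val w (fst (r, m)) (Less (Reg i) b)"
      using bound[OF Suc.prems(2)] Suc.prems by simp
    from exec.WhileTrue[OF this step 2(1)] show ?case
      using 1(2) 2(2,3)
      by (intro exI[of _ "1 + (t1 + 1) + t2"] exI[of _ r2] exI[of _ m2]) simp
  qed
  show ?thesis
    unfolding triple_def
  proof (intro allI impI)
    fix r m assume I: "I 0 (r(i := 0)) m"
    obtain t r' m' where *: "exec w (While (Less (Reg i) b) ?c) (r(i := 0), m) t (r', m')"
        "t \<le> 1 + N * (T + 2)" "I N r' m'"
      using loop[OF _ I] by auto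
    have "exec w (Op i Mul (Const 0) (Const 0)) (r, m) 1 (r(i := 0), m)"
      using exec.Op[of w i Mul "Const 0" "Const 0" r m] by simp
    from exec.Seq[OF this *(1)]
    show "\<exists>t r' m'. exec w (For i b c) (r, m) t (r', m') \<and> t \<le> 2 + N * (T + 2) \<and> I N r' m'"
      unfolding For_def using *(2,3)
      by (intro exI[of _ "1 + t"] exI[of _ r'] exI[of _ m']) simp
  qed
qed

text \<open>The closing \<open>Skip\<close> costs one step, so the cost of a block is one more than
  the sum over its commands.\<close>

definition block :: "com list \<Rightarrow> com" where
  "block cs = foldr Seq cs Skip"

lemma block_simps [simp]: "block [] = Skip" "block (c # cs) = Seq c (block cs)"
  by (simp_all add: block_def)

section \<open>Multi-word numbers\<close>

text \<open>Memory is divided into blocks of \<open>n\<close> cells. Blocks \<open>0, \<dots>, n - 1\<close> are the rows of the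
  adjacency matrix \<open>A\<close>; any later block \<open>q\<close> holds the \<open>n\<close> low bits of the unbounded ghost
  value \<open>V q\<close>.\<close>

definition represents ::
  "nat \<Rightarrow> (nat \<Rightarrow> nat \<Rightarrow> nat) \<Rightarrow> (nat \<Rightarrow> nat) \<Rightarrow> (nat \<Rightarrow> nat) \<Rightarrow> bool" where
  "represents n A V m \<longleftrightarrow>
     (\<forall>u<n. \<forall>v<n. m (u * n + v) = A u v) \<and>
     (\<forall>q\<ge>n. \<forall>i<n. m (q * n + i) = V q div 2 ^ i mod 2)"

lemma block_address_eq:
  fixes n :: nat
  assumes "i < n" "i' < n"
  shows "q * n + i = q' * n + i' \<longleftrightarrow> q = q' \<and> i = i'"
proof
  assume *: "q * n + i = q' * n + i'"
  have "(q * n + i) div n = q" "(q * n + i) mod n = i"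
    "(q' * n + i') div n = q'" "(q' * n + i') mod n = i'"
    using assms by simp_all
  then show "q = q' \<and> i = i'" using * by simp
qed simp

lemma represents_store_1:
  assumes "represents n A V m" "n \<le> q" "V q = 0" "0 < n"
  shows "represents n A (V(q := 1)) (m(q * n := 1))"
proof -
  have *: "q' * n + i = q * n \<longleftrightarrow> q' = q \<and> i = 0" if "i < n" for q' i
    using block_address_eq[of i n 0 q' q] that by auto
  have "Suc 0 div 2 ^ i = 0" if "0 < i" for i
    using one_less_power[of "2 :: nat" i] that by simp
  then show ?thesis
    using assms unfolding represents_def by (auto simp: *)
qed

text \<open>Schoolbook addition: \<open>(a mod 2 ^ i + b mod 2 ^ i) div 2 ^ i\<close> is the carry
  into position \<open>i\<close>. The first claim gives the digit written there, the second the next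
  carry.\<close>

lemma add_digit:
  fixes a b :: nat
  shows "(a + b) div 2 ^ i mod 2 =
      (a div 2 ^ i mod 2 + b div 2 ^ i mod 2 + (a mod 2 ^ i + b mod 2 ^ i) div 2 ^ i) mod 2"
    and "(a mod 2 ^ Suc i + b mod 2 ^ Suc i) div 2 ^ Suc i =
      (a div 2 ^ i mod 2 + b div 2 ^ i mod 2 + (a mod 2 ^ i + b mod 2 ^ i) div 2 ^ i) div 2"
proof -
  have m: "(x + y + z) mod 2 = (x mod 2 + y mod 2 + z) mod 2" for x y z :: nat
    by (metis mod_add_eq mod_add_left_eq)
  have d: "(a + b) div 2 ^ i = a div 2 ^ i + b div 2 ^ i + (a mod 2 ^ i + b mod 2 ^ i) div 2 ^ i"
    by (rule div_add1_eq)
  show "(a + b) div 2 ^ i mod 2 =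
      (a div 2 ^ i mod 2 + b div 2 ^ i mod 2 + (a mod 2 ^ i + b mod 2 ^ i) div 2 ^ i) mod 2"
    unfolding d by (rule m)
  have *: "x mod 2 ^ Suc i = 2 ^ i * (x div 2 ^ i mod 2) + x mod 2 ^ i" for x :: nat
    by (simp only: power_Suc2 mod_mult2_eq)
  have "a mod 2 ^ Suc i + b mod 2 ^ Suc i =
      2 ^ i * (a div 2 ^ i mod 2 + b div 2 ^ i mod 2) + (a mod 2 ^ i + b mod 2 ^ i)"
    unfolding * by (simp add: distrib_left)
  then have "(a mod 2 ^ Suc i + b mod 2 ^ Suc i) div 2 ^ i =
      a div 2 ^ i mod 2 + b div 2 ^ i mod 2 + (a mod 2 ^ i + b mod 2 ^ i) div 2 ^ i"
    by simp
  then show "(a mod 2 ^ Suc i + b mod 2 ^ Suc i) div 2 ^ Suc i =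
      (a div 2 ^ i mod 2 + b div 2 ^ i mod 2 + (a mod 2 ^ i + b mod 2 ^ i) div 2 ^ i) div 2"
    by (simp only: power_Suc2 div_mult2_eq)
qed

text \<open>Replaces the modular definition as simplification rule, so that subtractions without
  borrow become subtractions of naturals.\<close>

lemma binop_val_Sub: "y \<le> x \<Longrightarrow> x < 2 ^ w \<Longrightarrow> binop_val w Sub x y = x - y"
proof -
  assume *: "y \<le> x" "x < 2 ^ w"
  have "int (x - y) < int (2 ^ w)" using * by linarith
  then have "int (x - y) mod 2 ^ w = int (x - y)" by (intro mod_pos_pos_trivial) simp_all
  then show "binop_val w Sub x y = x - y" using * by (simp add: of_nat_diff)
qed

declare binop_val.simps(2) [simp del] binop_val_Sub [simp]

text \<open>Register 9 is the source address, 4 the target address, 11 the carry.\<close>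

definition add_blocks :: com where
  "add_blocks = Seq (Op 11 Mul (Const 0) (Const 0)) (For 12 (Reg 0) (block
     [Op 13 Add (Reg 9) (Reg 12), Load 13 (Reg 13),
      Op 14 Add (Reg 4) (Reg 12), Load 15 (Reg 14),
      Op 13 Add (Reg 13) (Reg 15), Op 13 Add (Reg 13) (Reg 11),
      Op 11 Mul (Const 0) (Const 0),
      If (Less (Reg 13) (Const 2)) Skip
        (Seq (Op 13 Sub (Reg 13) (Const 2)) (Op 11 Add (Const 1) (Const 0))),
      Store (Reg 14) (Reg 13)]))"

text \<open>\<open>F\<close> is a frame: it collects facts about registers below 11, since the code
  writes only registers 11 to 15. The carry out of the last cell is dropped, which leaves exactly
  the low bits of the unbounded sum. \<open>4 \<le> n\<close> makes words large enough for a digit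
  sum of up to 3.\<close>

lemma triple_add_blocks:
  assumes pq: "p \<noteq> q" "n \<le> p" "n \<le> q" and W: "p * n + n < 2 ^ w" "q * n + n < 2 ^ w" "4 \<le> n"
    and F [simp]: "\<And>r x v. 11 \<le> x \<Longrightarrow> F (r(x := v)) = F r"
  shows "triple w (\<lambda>r m. F r \<and> r 0 = n \<and> r 9 = p * n \<and> r 4 = q * n \<and> represents n A V m)
    add_blocks (20 * n + 3) (\<lambda>r m. F r \<and> represents n A (V(q := V q + V p)) m)"
proof -
  let ?c = "\<lambda>i. (V p mod 2 ^ i + V q mod 2 ^ i) div 2 ^ i"
  \<comment> \<open>Midway the target block mixes digits of the sum, below \<open>i\<close>, with
    old digits, so \<open>represents\<close> has to be opened up.\<close>
  let ?I = "\<lambda>i r m. F r \<and> r 0 = n \<and> r 9 = p * n \<and> r 4 = q * n \<and> r 11 = ?c i \<and>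
    (\<forall>u<n. \<forall>v<n. m (u * n + v) = A u v) \<and>
    (\<forall>q'\<ge>n. \<forall>j<n. m (q' * n + j) = (if q' = q \<and> j < i then V p + V q else V q') div 2 ^ j mod 2)"
  have n: "n < 2 ^ w" using W by linarith
  have c: "?c i \<le> 1" for i
  proof -
    have "V p mod 2 ^ i < 2 ^ i" "V q mod 2 ^ i < 2 ^ i" by simp_all
    then have "V p mod 2 ^ i + V q mod 2 ^ i < 2 * 2 ^ i" by linarith
    then have "?c i < 2" by (simp add: div_less_iff_less_mult)
    then show ?thesis by simp
  qed
  have body: "triple w (\<lambda>r m. ?I i r m \<and> r 12 = i) (block
     [Op 13 Add (Reg 9) (Reg 12), Load 13 (Reg 13),
      Op 14 Add (Reg 4) (Reg 12), Load 15 (Reg 14),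
      Op 13 Add (Reg 13) (Reg 15), Op 13 Add (Reg 13) (Reg 11),
      Op 11 Mul (Const 0) (Const 0),
      If (Less (Reg 13) (Const 2)) Skip
        (Seq (Op 13 Sub (Reg 13) (Const 2)) (Op 11 Add (Const 1) (Const 0))),
      Store (Reg 14) (Reg 13)]) 12 (\<lambda>r m. r 12 = i \<and> ?I (Suc i) (r(12 := Suc i)) m)"
    (is "triple _ _ ?body _ _") if i: "i < n" for i
  proof (rule triple_straight)
    fix r m assume I: "?I i r m \<and> r 12 = i"
    define x y z where "x = V p div 2 ^ i mod 2" and "y = V q div 2 ^ i mod 2" and "z = ?c i"
    have d: "?c (Suc i) = (x + y + z) div 2" "(V p + V q) div 2 ^ i mod 2 = (x + y + z) mod 2"
      unfolding x_def y_def z_def by (rule add_digit)+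
    have "x \<le> 1" "y \<le> 1" "z \<le> 1" using c[of i] by (auto simp: x_def y_def z_def)
    then have b: "x + y < 2 ^ w" "x + y + z < 2 ^ w" "x + y + z \<le> 3" "2 < (2::nat) ^ w" using n W by linarith+
    then have "0 < w" by (cases w) simp_all
    have a: "p * n + i < 2 ^ w" "q * n + i < 2 ^ w" using W i by linarith+
    have mem: "m (p * n + i) = x" "m (q * n + i) = y" "r 11 = z"
      using I i pq unfolding x_def y_def z_def by auto
    have r: "F r" "r 0 = n" "r 9 = p * n" "r 4 = q * n" "r 12 = i" using I by auto
    define r' where "r' = fst (run w ?body (r, m))"
    have "snd (run w ?body (r, m)) = m(q * n + i := (x + y + z) mod 2) \<and>
      F r' \<and> r' 0 = n \<and> r' 9 = p * n \<and> r' 4 = q * n \<and> r' 12 = i \<and> r' 11 = (x + y + z) div 2"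
    proof (cases "x + y + z < 2")
      case True
      then show ?thesis using b a mem r by (simp add: r'_def)
    next
      case False
      then have "(x + y + z) mod 2 = x + y + z - 2" "(x + y + z) div 2 = 1" using b by presburger+
      then show ?thesis using False b a mem r \<open>0 < w\<close> by (simp add: r'_def)
    qed
    then have run: "run w ?body (r, m) = (r', m(q * n + i := (x + y + z) mod 2))"
      and r': "F r'" "r' 0 = n" "r' 9 = p * n" "r' 4 = q * n" "r' 12 = i" "r' 11 = (x + y + z) div 2"
      by (simp_all only: r'_def prod_eq_iff fst_conv snd_conv simp_thms)
    let ?m = "m(q * n + i := (x + y + z) mod 2)"
    have "\<forall>u<n. \<forall>v<n. ?m (u * n + v) = A u v"
    proof (intro allI impI)
      fix u v assume "u < n" "v < n"
      then show "?m (u * n + v) = A u v"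
        using block_address_eq[of v n i u q] i pq I by simp
    qed
    moreover have "\<forall>q'\<ge>n. \<forall>j<n.
      ?m (q' * n + j) = (if q' = q \<and> j < Suc i then V p + V q else V q') div 2 ^ j mod 2"
    proof (intro allI impI)
      fix q' j assume *: "n \<le> q'" "j < n"
      show "?m (q' * n + j) = (if q' = q \<and> j < Suc i then V p + V q else V q') div 2 ^ j mod 2"
      proof (cases "q' = q \<and> j = i")
        case True
        then show ?thesis using d(2) by simp
      next
        case False
        then have "?m (q' * n + j) = m (q' * n + j)"
          using block_address_eq[of j n i q' q] *(2) i by auto
        then show ?thesis using I * False by (auto simp: less_Suc_eq)
      qed
    qed
    ultimately have "?I (Suc i) (r'(12 := Suc i)) ?m"
      using r' d(1) by simp
    then show "case run w ?body (r, m) of (r', m') \<Rightarrow> r' 12 = i \<and> ?I (Suc i) (r'(12 := Suc i)) m'"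
      unfolding run using r'(5) by simp
  qed simp_all
  have loop: "triple w (\<lambda>r m. ?I 0 (r(12 := 0)) m) (For 12 (Reg 0) ?body) (2 + n * (12 + 2)) (\<lambda>r m. ?I n r m)"
    by (rule triple_For[OF body _ n]) simp_all
  have init: "triple w (\<lambda>r m. F r \<and> r 0 = n \<and> r 9 = p * n \<and> r 4 = q * n \<and> represents n A V m)
      (Op 11 Mul (Const 0) (Const 0)) 1 (\<lambda>r m. ?I 0 (r(12 := 0)) m)"
    by (rule triple_straight) (auto simp: represents_def)
  show ?thesis
    unfolding add_blocks_def
  proof (rule triple_conseq[OF triple_Seq[OF init loop]])
    show "F r \<and> represents n A (V(q := V q + V p)) m" if "?I n r m" for r m
      using that by (auto simp: represents_def add.commute)
  qed auto
qed

section \<open>The counting program\<close>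

text \<open>Block \<open>n + i * n + c\<close> of the table holds \<open>c choose i\<close>, block \<open>n + n * n\<close> the running
  total. Registers: 0 is \<open>n\<close>, 2 is \<open>n - 1\<close>, 3 is \<open>k - 3\<close>; 4 and 9 hold the target and source
  address for \<^const>\<open>add_blocks\<close>; 5, 6, 7 are loop counters, in the summation the vertices
  \<open>b\<close>, \<open>t\<close>, \<open>s\<close>.\<close>

definition init_table :: com where
  "init_table = For 5 (Reg 0) (block
     [Op 7 Add (Reg 0) (Reg 5), Op 7 Mul (Reg 7) (Reg 0), Store (Reg 7) (Const 1)])"

text \<open>If block \<open>q\<close> holds \<open>c choose i\<close>, then \<open>q + n\<close>
  holds \<open>c choose (i + 1)\<close>, and \<open>q + n + 1\<close> is the place of
  \<open>(c + 1) choose (i + 1)\<close>. Register 10 saves the second source address across the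
  first addition.\<close>

definition fill_entry :: com where
  "fill_entry = Seq (block
     [Op 7 Mul (Reg 5) (Reg 0), Op 7 Add (Reg 7) (Reg 6), Op 7 Add (Reg 7) (Reg 0),
      Op 9 Mul (Reg 7) (Reg 0),
      Op 7 Add (Reg 7) (Reg 0), Op 10 Mul (Reg 7) (Reg 0), Op 4 Add (Reg 10) (Reg 0)])
     (Seq add_blocks (Seq (Op 9 Add (Reg 10) (Const 0)) add_blocks))"

definition fill_table :: com where
  "fill_table = For 5 (Reg 2) (For 6 (Reg 2) fill_entry)"

definition fetch :: "nat \<Rightarrow> nat \<Rightarrow> nat \<Rightarrow> com" where
  "fetch i x y = block [Op i Mul (Reg x) (Reg 0), Op i Add (Reg i) (Reg y), Load i (Reg i)]"

definition count_candidates :: com where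
  "count_candidates = For 10 (Reg 0) (block
     [fetch 13 5 10, fetch 14 6 10, fetch 15 7 10,
      Op 14 Sub (Const 1) (Reg 14), Op 13 Mul (Reg 13) (Reg 14),
      Op 15 Sub (Const 1) (Reg 15), Op 13 Mul (Reg 13) (Reg 15), Op 8 Add (Reg 8) (Reg 13)])"

definition process_triple :: com where
  "process_triple = Seq (Op 8 Mul (Const 0) (Const 0)) (Seq count_candidates (Seq (block
     [fetch 13 5 6, Op 8 Mul (Reg 8) (Reg 13), fetch 13 6 7, Op 8 Mul (Reg 8) (Reg 13),
      fetch 13 5 7, Op 13 Sub (Const 1) (Reg 13), Op 8 Mul (Reg 8) (Reg 13),
      Op 9 Mul (Reg 3) (Reg 0), Op 9 Add (Reg 9) (Reg 8), Op 9 Add (Reg 9) (Reg 0),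
      Op 9 Mul (Reg 9) (Reg 0)]) add_blocks))"

definition sum_triples :: com where
  "sum_triples = Seq
     (block [Op 4 Mul (Reg 0) (Reg 0), Op 4 Add (Reg 4) (Reg 0), Op 4 Mul (Reg 4) (Reg 0)])
     (For 5 (Reg 0) (For 6 (Reg 0) (For 7 (Reg 0) process_triple)))"

text \<open>At the end \<open>n\<close> becomes the output length. It is copied to register 1 before
  register 0 is overwritten with the address of the total, still in register 4.\<close>

definition count_scorpions :: com where
  "count_scorpions = Seq (block [Op 2 Sub (Reg 0) (Const 1), Op 3 Sub (Reg 1) (Const 3)])
     (Seq init_table (Seq fill_table (Seq sum_triples
       (block [Op 1 Add (Reg 0) (Const 0), Op 0 Add (Reg 4) (Const 0)]))))"

text \<open>Setting register 1 to 0 declares an output of no bits, which denotes the number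
  0.\<close>

definition scorpion_program :: com where
  "scorpion_program = If (Less (Reg 1) (Const 5)) (Op 1 Mul (Const 0) (Const 0))
     (If (Less (Reg 0) (Reg 1)) (Op 1 Mul (Const 0) (Const 0)) count_scorpions)"

text \<open>The table contents when rows up to \<open>i\<close> and row \<open>i + 1\<close> up to column \<open>c\<close> are filled.\<close>

definition pascal :: "nat \<Rightarrow> nat \<Rightarrow> nat \<Rightarrow> nat \<Rightarrow> nat" where
  "pascal n i c q =
     (if n \<le> q \<and> q < n + n * n \<and>
         ((q - n) div n \<le> i \<or> (q - n) div n = Suc i \<and> (q - n) mod n \<le> c)
      then (q - n) mod n choose ((q - n) div n) else 0)"

section \<open>Filling Pascal's triangle\<close>

lemma pascal_index:
  assumes "c < n"
  shows "pascal n i' c' (n + i * n + c) =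
    (if i < n \<and> (i \<le> i' \<or> i = Suc i' \<and> c \<le> c') then c choose i else 0)"
proof -
  have "(i * n + c) div n = i" "(i * n + c) mod n = c" using assms by simp_all
  moreover have "i * n + c < n * n \<longleftrightarrow> i < n"
  proof
    assume "i * n + c < n * n"
    then have "i * n < n * n" by linarith
    then show "i < n" by simp
  next
    assume "i < n"
    then have "Suc i * n \<le> n * n" by (intro mult_le_mono1) simp
    then show "i * n + c < n * n" using assms by simp
  qed
  ultimately show ?thesis using assms by (auto simp: pascal_def add.assoc)
qed


lemma block_cases:
  fixes q n :: nat
  obtains "q < n" | "n + n * n \<le> q" | i c where "q = n + i * n + c" "i < n" "c < n"
proof -
  consider "q < n" | "n + n * n \<le> q" | "n \<le> q" "q < n + n * n" by linarith
  then show ?thesis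
  proof cases
    case 3
    have "0 < n" using 3 by (cases n) simp_all
    moreover have "(q - n) div n < n" using 3 by (simp add: less_mult_imp_div_less)
    moreover have "q = n + (q - n) div n * n + (q - n) mod n" using 3 by simp
    ultimately show ?thesis using that(3) by (metis mod_less_divisor)
  qed (use that in auto)
qed

text \<open>Row 0 consists of ones, and the entry of row 1 in column 0 is
  \<open>0 choose 1 = 0\<close>, the same as an unfilled block.\<close>

lemma pascal_0: "pascal n 0 0 q = of_bool (n \<le> q \<and> q < n + n)"
proof (cases rule: block_cases[of q n])
  case (3 i c)
  have "n + i * n + c < n + n \<longleftrightarrow> i = 0"
    using 3 by (cases i) auto
  then show ?thesis using 3 pascal_index[of c n 0 0 i]
    by (cases i) (auto simp: binomial_eq_0)
next
  case 2
  then have "\<not> q < n + n" using le_square[of n] by linarith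
  then show ?thesis using 2 by (simp add: pascal_def)
qed (simp add: pascal_def)

text \<open>Passing to the next row costs nothing: its entry in column 0 is a binomial
  \<open>0 choose i\<close> with positive \<open>i\<close>, hence 0 like an unfilled block.\<close>

lemma pascal_Suc:
  assumes "0 < n"
  shows "pascal n i (n - 1) = pascal n (Suc i) 0"
proof
  fix q show "pascal n i (n - 1) q = pascal n (Suc i) 0 q"
  proof (cases rule: block_cases[of q n])
    case (3 i' c)
    then show ?thesis using pascal_index[of c n] by (auto simp: binomial_eq_0)
  qed (simp_all add: pascal_def)
qed

text \<open>Pascal's rule. The second claim records that the target is still 0, so accumulating two
  summands there yields exactly their sum.\<close>

lemma pascal_step:
  assumes "Suc i < n" "Suc c < n"
  defines "V \<equiv> pascal n i c" and "q \<equiv> n + i * n + c"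
  shows "V(q + n + 1 := V q + V (q + n)) = pascal n i (Suc c)"
    and "V (q + n + 1) = 0"
proof -
  have d: "q + n + 1 = n + Suc i * n + Suc c" "q + n = n + Suc i * n + c" by (simp_all add: q_def)
  show 0: "V (q + n + 1) = 0"
    unfolding V_def d(1) using assms(1,2) by (subst pascal_index) simp_all
  have V: "V q = c choose i" "V (q + n) = c choose Suc i"
      "pascal n i (Suc c) (q + n + 1) = Suc c choose Suc i"
    unfolding V_def d(1) unfolding d(2) unfolding q_def
    using assms(1,2) by (subst pascal_index; simp)+
  show "V(q + n + 1 := V q + V (q + n)) = pascal n i (Suc c)"
  proof
    fix x show "(V(q + n + 1 := V q + V (q + n))) x = pascal n i (Suc c) x"
    proof (cases "x = q + n + 1")
      case True
      then show ?thesis using V by simp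
    next
      case False
      then show ?thesis
      proof (cases rule: block_cases[of x n])
        case (3 i' c')
        then have "\<not> (i' = Suc i \<and> c' = Suc c)" using False d by auto
        then show ?thesis using False 3 pascal_index[of c' n] by (auto simp: V_def)
      qed (use False in \<open>simp_all add: V_def pascal_def\<close>)
    qed
  qed
qed

section \<open>Correctness and cost of the phases\<close>

text \<open>\<open>j\<close> stands for \<open>k - 3\<close> and \<open>A\<close> for the adjacency
  matrix. The bound on \<open>w\<close> covers all addresses up to the end of the last block, the
  running total.\<close>

locale counting =
  fixes n j w :: nat and A :: "nat \<Rightarrow> nat \<Rightarrow> nat"
  assumes A_le: "A u v \<le> 1" and A_diag: "A u u = 0"
    and n: "5 \<le> n" and j: "j < n" and w: "(n + n * n) * n + n < 2 ^ w"
begin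

lemma block_bound:
  assumes "q \<le> n + n * n"
  shows "q * n + n < 2 ^ w" "q * n < 2 ^ w" "q < 2 ^ w"
proof -
  have "q * n + n \<le> (n + n * n) * n + n" using assms by simp
  then show 1: "q * n + n < 2 ^ w" using w by linarith
  then show "q * n < 2 ^ w" by linarith
  have "q * 1 \<le> q * n" using n by (intro mult_le_mono2) simp
  then show "q < 2 ^ w" using 1 by linarith
qed

lemma index_bound: "i < n \<Longrightarrow> c < n \<Longrightarrow> i * n + c < n * n"
  using pascal_index[of c n] mult_le_mono1[of "Suc i" n n] by simp

lemma n_bound: "n < 2 ^ w" using block_bound[of n] by simp

lemma w_pos: "0 < w" using n_bound n by (cases w) simp_all

definition regs :: "(nat \<Rightarrow> nat) \<Rightarrow> bool" where
  "regs r \<longleftrightarrow> r 0 = n \<and> r 2 = n - 1 \<and> r 3 = j"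

lemma regs_upd [simp]: "4 \<le> x \<Longrightarrow> regs (r(x := v)) = regs r"
  by (simp add: regs_def)

lemma regsD: "regs r \<Longrightarrow> r 0 = n" "regs r \<Longrightarrow> r 2 = n - 1" "regs r \<Longrightarrow> r 3 = j"
  by (simp_all add: regs_def)

lemma triple_init_table:
  "triple w (\<lambda>r m. regs r \<and> represents n A (\<lambda>_. 0) m) init_table (2 + n * 6)
     (\<lambda>r m. regs r \<and> represents n A (pascal n 0 0) m)"
proof -
  let ?V = "\<lambda>c q. of_bool (n \<le> q \<and> q < n + c) :: nat"
  let ?I = "\<lambda>c r m. regs r \<and> represents n A (?V c) m"
  have body: "triple w (\<lambda>r m. ?I c r m \<and> r 5 = c) (block
      [Op 7 Add (Reg 0) (Reg 5), Op 7 Mul (Reg 7) (Reg 0), Store (Reg 7) (Const 1)]) 4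
      (\<lambda>r m. r 5 = c \<and> ?I (Suc c) (r(5 := Suc c)) m)" (is "triple _ _ ?c _ _") if "c < n" for c
  proof (rule triple_straight)
    fix r m assume I: "?I c r m \<and> r 5 = c"
    have "n + c \<le> n + n * n" using index_bound[of 0 c] that by linarith
    note b = block_bound[OF this]
    have "(?V c)(n + c := 1) = ?V (Suc c)" by (auto simp: fun_eq_iff)
    then have "represents n A (?V (Suc c)) (m((n + c) * n := 1))"
      using represents_store_1[of n A "?V c" m "n + c"] I that by simp
    then show "case run w ?c (r, m) of (r', m') \<Rightarrow> r' 5 = c \<and> ?I (Suc c) (r'(5 := Suc c)) m'"
      using I regsD(1)[of r] b w_pos by simp
  qed simp_all
  have loop: "triple w (\<lambda>r m. ?I 0 (r(5 := 0)) m) init_table (2 + n * (4 + 2)) (\<lambda>r m. ?I n r m)"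
    unfolding init_table_def by (rule triple_For[OF body]) (use n_bound in \<open>auto simp: regsD\<close>)
  have V: "?V 0 = (\<lambda>_. 0)" "?V n = pascal n 0 0" by (auto simp: fun_eq_iff pascal_0)
  show ?thesis
    by (rule triple_conseq[OF loop[unfolded V]]) simp_all
qed

lemma triple_fill_entry:
  assumes i: "i < n - 1" and c: "c < n - 1"
  shows "triple w (\<lambda>r m. regs r \<and> r 5 = i \<and> r 6 = c \<and> represents n A (pascal n i c) m)
    fill_entry (40 * n + 20)
    (\<lambda>r m. regs r \<and> r 5 = i \<and> r 6 = c \<and> represents n A (pascal n i (Suc c)) m)"
proof -
  let ?q = "n + i * n + c" and ?V = "pascal n i c"
  let ?d = "?q + n + 1"
  let ?F = "\<lambda>r. regs r \<and> r 5 = i \<and> r 6 = c \<and> r 10 = (?q + n) * n"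
  have "Suc i * n + Suc c < n * n" using index_bound[of "Suc i" "Suc c"] i c by linarith
  then have "?q \<le> n + n * n" "?q + n \<le> n + n * n" "?d \<le> n + n * n" by simp_all
  note b = block_bound[OF this(1)] block_bound[OF this(2)] block_bound[OF this(3)]
  have d: "?d * n = (?q + n) * n + n" by (simp add: distrib_right)
  have comm: "i * n + c + n = ?q" by simp
  have b': "i * n + c < 2 ^ w" "i * n < 2 ^ w" using b(3) by linarith+
  have 1: "triple w (\<lambda>r m. regs r \<and> r 5 = i \<and> r 6 = c \<and> represents n A ?V m) (block
     [Op 7 Mul (Reg 5) (Reg 0), Op 7 Add (Reg 7) (Reg 6), Op 7 Add (Reg 7) (Reg 0),
      Op 9 Mul (Reg 7) (Reg 0),
      Op 7 Add (Reg 7) (Reg 0), Op 10 Mul (Reg 7) (Reg 0), Op 4 Add (Reg 10) (Reg 0)]) 8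
     (\<lambda>r m. ?F r \<and> r 0 = n \<and> r 9 = ?q * n \<and> r 4 = ?d * n \<and> represents n A ?V m)"
    (is "triple _ _ ?c _ _")
  proof (rule triple_straight)
    fix r m assume I: "regs r \<and> r 5 = i \<and> r 6 = c \<and> represents n A ?V m"
    then show "case run w ?c (r, m) of (r, m) \<Rightarrow>
        ?F r \<and> r 0 = n \<and> r 9 = ?q * n \<and> r 4 = ?d * n \<and> represents n A ?V m"
      using b[unfolded d] b' regsD(1)[of r] unfolding d by (simp add: comm)
  qed simp_all
  \<comment> \<open>Register 4 joins the frame, because the second addition reuses the target
    address.\<close>
  have 2: "triple w (\<lambda>r m. ?F r \<and> r 0 = n \<and> r 9 = ?q * n \<and> r 4 = ?d * n \<and> represents n A ?V m)
      add_blocks (20 * n + 3) (\<lambda>r m. (?F r \<and> r 4 = ?d * n) \<and> represents n A (?V(?d := ?V ?d + ?V ?q)) m)"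
    by (rule triple_conseq[OF triple_add_blocks[of ?q ?d n w "\<lambda>r. ?F r \<and> r 4 = ?d * n"]])
      (use b n in auto)
  have 3: "triple w (\<lambda>r m. (?F r \<and> r 4 = ?d * n) \<and> represents n A (?V(?d := ?V ?d + ?V ?q)) m)
      (Op 9 Add (Reg 10) (Const 0)) 1
      (\<lambda>r m. ?F r \<and> r 0 = n \<and> r 9 = (?q + n) * n \<and> r 4 = ?d * n \<and>
        represents n A (?V(?d := ?V ?d + ?V ?q)) m)"
    by (rule triple_straight) (use b in \<open>auto simp: regsD\<close>)
  let ?V' = "?V(?d := ?V ?d + ?V ?q)"
  have V': "?V'(?d := ?V' ?d + ?V' (?q + n)) = pascal n i (Suc c)"
    using pascal_step[of i n c] i c by simp
  have 4: "triple w (\<lambda>r m. ?F r \<and> r 0 = n \<and> r 9 = (?q + n) * n \<and> r 4 = ?d * n \<and>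
        represents n A ?V' m)
      add_blocks (20 * n + 3) (\<lambda>r m. ?F r \<and> represents n A (pascal n i (Suc c)) m)"
    unfolding V'[symmetric]
    by (rule triple_add_blocks) (use b n in auto)
  show ?thesis
    unfolding fill_entry_def
    by (rule triple_conseq[OF triple_Seq[OF 1 triple_Seq[OF 2 triple_Seq[OF 3 4]]]]) auto
qed

lemma triple_fill_table:
  "triple w (\<lambda>r m. regs r \<and> represents n A (pascal n 0 0) m) fill_table
     (2 + n * (2 + n * (40 * n + 22) + 2))
     (\<lambda>r m. regs r \<and> represents n A (pascal n (n - 1) 0) m)"
proof -
  let ?J = "\<lambda>i c r m. regs r \<and> r 5 = i \<and> represents n A (pascal n i c) m"
  let ?I = "\<lambda>i r m. regs r \<and> represents n A (pascal n i 0) m"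
  have b: "n - 1 < 2 ^ w" using n_bound by linarith
  have inner: "triple w (\<lambda>r m. ?J i 0 (r(6 := 0)) m) (For 6 (Reg 2) fill_entry)
      (2 + (n - 1) * (40 * n + 20 + 2)) (\<lambda>r m. ?J i (n - 1) r m)" if "i < n - 1" for i
  proof (rule triple_For)
    fix c assume "c < n - 1"
    then show "triple w (\<lambda>r m. ?J i c r m \<and> r 6 = c) fill_entry (40 * n + 20)
        (\<lambda>r m. r 6 = c \<and> ?J i (Suc c) (r(6 := Suc c)) m)"
      by (intro triple_conseq[OF triple_fill_entry[OF that]]) auto
  qed (use b in \<open>auto simp: regsD\<close>)
  have outer: "triple w (\<lambda>r m. ?I 0 (r(5 := 0)) m) fill_table
      (2 + (n - 1) * (2 + (n - 1) * (40 * n + 20 + 2) + 2)) (\<lambda>r m. ?I (n - 1) r m)"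
    unfolding fill_table_def
  proof (rule triple_For)
    fix i assume "i < n - 1"
    then show "triple w (\<lambda>r m. ?I i r m \<and> r 5 = i) (For 6 (Reg 2) fill_entry)
        (2 + (n - 1) * (40 * n + 20 + 2)) (\<lambda>r m. r 5 = i \<and> ?I (Suc i) (r(5 := Suc i)) m)"
      by (intro triple_conseq[OF inner]) (use n pascal_Suc[of n i] in auto)
  qed (use b in \<open>auto simp: regsD\<close>)
  have "(n - 1) * (40 * n + 20 + 2) \<le> n * (40 * n + 22)"
    by (rule mult_le_mono) simp_all
  then have "(n - 1) * (2 + (n - 1) * (40 * n + 20 + 2) + 2) \<le> n * (2 + n * (40 * n + 22) + 2)"
    by (intro mult_le_mono) linarith+
  then have le: "2 + (n - 1) * (2 + (n - 1) * (40 * n + 20 + 2) + 2) \<le> 2 + n * (2 + n * (40 * n + 22) + 2)"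
    by linarith
  show ?thesis
    by (rule triple_conseq[OF outer _ _ le]) auto
qed


lemma candidate_term_le: "A b v * (1 - A t v) * (1 - A s v) \<le> 1"
  using mult_le_mono[OF mult_le_mono[OF A_le[of b v] diff_le_self[of 1 "A t v"]] diff_le_self[of 1 "A s v"]]
  by simp

text \<open>The summand for \<open>v = b\<close> vanishes by the zero diagonal. Strictness matters:
  the count serves as a column index of the table.\<close>

lemma candidate_count_less:
  assumes "b < n"
  shows "(\<Sum>v<n. A b v * (1 - A t v) * (1 - A s v)) < n"
proof -
  let ?f = "\<lambda>v. A b v * (1 - A t v) * (1 - A s v)"
  have "(\<Sum>v<n. ?f v) = (\<Sum>v\<in>{..<n} - {b}. ?f v)"
    by (rule sum.mono_neutral_right) (auto simp: A_diag)
  also have "\<dots> \<le> card ({..<n} - {b})"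
    using sum_bounded_above[of "{..<n} - {b}" ?f 1] candidate_term_le by simp
  also have "\<dots> < n" using assms by simp
  finally show ?thesis .
qed

lemma address_bound: "i < n \<Longrightarrow> c < n \<Longrightarrow> i * n + c < 2 ^ w"
  using index_bound[of i c] block_bound(3)[of "n * n"] by simp

lemma row_bound: "i < n \<Longrightarrow> i * n < 2 ^ w"
  using address_bound[of i 0] n by simp

lemma representsD: "represents n A V m \<Longrightarrow> u < n \<Longrightarrow> v < n \<Longrightarrow> m (u * n + v) = A u v"
  by (simp add: represents_def)

lemma triple_count_candidates:
  assumes bts: "b < n" "t < n" "s < n"
    and F: "\<And>r. F r \<Longrightarrow> regs r \<and> r 5 = b \<and> r 6 = t \<and> r 7 = s"
    and F_upd [simp]: "\<And>r x v. 8 \<le> x \<Longrightarrow> F (r(x := v)) = F r"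
  shows "triple w (\<lambda>r m. F r \<and> r 8 = 0 \<and> represents n A V m) count_candidates (2 + n * 20)
    (\<lambda>r m. F r \<and> r 8 = (\<Sum>v<n. A b v * (1 - A t v) * (1 - A s v)) \<and> represents n A V m)"
proof -
  let ?f = "\<lambda>v. A b v * (1 - A t v) * (1 - A s v)"
  let ?I = "\<lambda>v r m. F r \<and> r 8 = (\<Sum>v<v. ?f v) \<and> represents n A V m"
  have body: "triple w (\<lambda>r m. ?I v r m \<and> r 10 = v) (block
     [fetch 13 5 10, fetch 14 6 10, fetch 15 7 10,
      Op 14 Sub (Const 1) (Reg 14), Op 13 Mul (Reg 13) (Reg 14),
      Op 15 Sub (Const 1) (Reg 15), Op 13 Mul (Reg 13) (Reg 15), Op 8 Add (Reg 8) (Reg 13)]) 18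
     (\<lambda>r m. r 10 = v \<and> ?I (Suc v) (r(10 := Suc v)) m)" (is "triple _ _ ?c _ _") if v: "v < n" for v
  proof (rule triple_straight)
    fix r m assume I: "?I v r m \<and> r 10 = v"
    define x y z S where "x = A b v" and "y = A t v" and "z = A s v" and "S = (\<Sum>v<v. ?f v)"
    have "x \<le> 1" "y \<le> 1" "z \<le> 1" using A_le by (auto simp: x_def y_def z_def)
    have "S \<le> v" using sum_bounded_above[of "{..<v}" ?f 1] candidate_term_le by (simp add: S_def)
    have xy: "x * (1 - y) \<le> 1" "x * (1 - y) * (1 - z) \<le> 1"
      using mult_le_mono[OF \<open>x \<le> 1\<close> diff_le_self[of 1 y]] candidate_term_le[of b v t s]
      by (simp_all add: x_def y_def z_def)
    then have bd: "x * (1 - y) < 2 ^ w" "x * (1 - y) * (1 - z) < 2 ^ w"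
        "S + x * (1 - y) * (1 - z) < 2 ^ w" "1 < (2::nat) ^ w"
      using \<open>S \<le> v\<close> n_bound n v by linarith+
    have mem: "m (b * n + v) = x" "m (t * n + v) = y" "m (s * n + v) = z"
      using I v bts representsD by (auto simp: x_def y_def z_def)
    have r: "F r" "r 0 = n" "r 5 = b" "r 6 = t" "r 7 = s" "r 10 = v" "r 8 = S"
      using I F[of r] by (auto simp: S_def regsD)
    have S': "(\<Sum>v<Suc v. ?f v) = S + x * (1 - y) * (1 - z)"
      by (simp add: S_def x_def y_def z_def)
    note ab = row_bound[OF bts(1)] row_bound[OF bts(2)] row_bound[OF bts(3)]
      address_bound[OF bts(1) v] address_bound[OF bts(2) v] address_bound[OF bts(3) v]
    show "case run w ?c (r, m) of (r', m') \<Rightarrow> r' 10 = v \<and> ?I (Suc v) (r'(10 := Suc v)) m'"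
      unfolding S' using bd mem r ab I w_pos \<open>y \<le> 1\<close> \<open>z \<le> 1\<close>
      by (simp add: fetch_def)
  qed (simp_all add: fetch_def)
  have "triple w (\<lambda>r m. ?I 0 (r(10 := 0)) m) count_candidates (2 + n * (18 + 2)) (\<lambda>r m. ?I n r m)"
    unfolding count_candidates_def
    by (rule triple_For[OF body]) (use n_bound in \<open>auto dest: F simp: regsD\<close>)
  then show ?thesis by simp
qed

definition table :: "nat \<Rightarrow> nat \<Rightarrow> nat" where
  "table S = (pascal n (n - 1) 0)(n + n * n := S)"

lemma table_0: "table 0 = pascal n (n - 1) 0"
  by (auto simp: table_def pascal_def fun_eq_iff)

lemma table_entry: "c < n \<Longrightarrow> table S (n + j * n + c) = c choose j"
  using j index_bound[of j c] by (auto simp: table_def pascal_index)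

lemma triple_process_triple:
  assumes bts: "b < n" "t < n" "s < n"
  shows "triple w
    (\<lambda>r m. (regs r \<and> r 4 = (n + n * n) * n \<and> r 5 = b \<and> r 6 = t \<and> r 7 = s) \<and> represents n A (table S) m)
    process_triple (40 * n + 30)
    (\<lambda>r m. (regs r \<and> r 4 = (n + n * n) * n \<and> r 5 = b \<and> r 6 = t \<and> r 7 = s) \<and>
      represents n A (table (S + (tail_weight A n b t s choose j))) m)"
proof -
  let ?F = "\<lambda>r. regs r \<and> r 4 = (n + n * n) * n \<and> r 5 = b \<and> r 6 = t \<and> r 7 = s"
  let ?c = "\<Sum>v<n. A b v * (1 - A t v) * (1 - A s v)"
  define k where "k = tail_weight A n b t s"
  let ?p = "n + j * n + k"
  have k_le: "?c * A b t \<le> ?c" "?c * A b t * A t s \<le> ?c" "?c * A b t * A t s * (1 - A b s) \<le> ?c"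
  proof -
    show 1: "?c * A b t \<le> ?c" using mult_le_mono2[OF A_le[of b t], of ?c] by simp
    have "?c * A b t * A t s \<le> ?c * A b t"
      using mult_le_mono2[OF A_le[of t s], of "?c * A b t"] by simp
    then show 2: "?c * A b t * A t s \<le> ?c" using 1 by linarith
    have "?c * A b t * A t s * (1 - A b s) \<le> ?c * A b t * A t s"
      using mult_le_mono2[OF diff_le_self[of 1 "A b s"], of "?c * A b t * A t s"] by simp
    then show "?c * A b t * A t s * (1 - A b s) \<le> ?c" using 2 by linarith
  qed
  have "k \<le> ?c" unfolding k_def tail_weight_def by (rule k_le(3))
  then have k: "k < n" using candidate_count_less[OF bts(1), of t s] by (rule le_less_trans)
  \<comment> \<open>The inequality separates the table entry from the running total, as
    \<open>triple_add_blocks\<close> requires distinct blocks.\<close>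
  have p: "?p \<le> n + n * n" "?p \<noteq> n + n * n" using index_bound[OF j k] by linarith+
  note pb = block_bound[OF p(1)]
  have 1: "triple w (\<lambda>r m. ?F r \<and> represents n A (table S) m) (Op 8 Mul (Const 0) (Const 0)) 1
      (\<lambda>r m. ?F r \<and> r 8 = 0 \<and> represents n A (table S) m)"
    by (rule triple_straight) auto
  have 2: "triple w (\<lambda>r m. ?F r \<and> r 8 = 0 \<and> represents n A (table S) m) count_candidates (2 + n * 20)
      (\<lambda>r m. ?F r \<and> r 8 = ?c \<and> represents n A (table S) m)"
    by (rule triple_count_candidates[OF bts]) auto
  have 3: "triple w (\<lambda>r m. ?F r \<and> r 8 = ?c \<and> represents n A (table S) m) (block
     [fetch 13 5 6, Op 8 Mul (Reg 8) (Reg 13), fetch 13 6 7, Op 8 Mul (Reg 8) (Reg 13),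
      fetch 13 5 7, Op 13 Sub (Const 1) (Reg 13), Op 8 Mul (Reg 8) (Reg 13),
      Op 9 Mul (Reg 3) (Reg 0), Op 9 Add (Reg 9) (Reg 8), Op 9 Add (Reg 9) (Reg 0),
      Op 9 Mul (Reg 9) (Reg 0)]) 24
     (\<lambda>r m. ?F r \<and> r 0 = n \<and> r 9 = ?p * n \<and> r 4 = (n + n * n) * n \<and> represents n A (table S) m)"
    (is "triple _ _ ?prog _ _")
  proof (rule triple_straight)
    fix r m assume I: "?F r \<and> r 8 = ?c \<and> represents n A (table S) m"
    define c x y z where "c = ?c" and "x = A b t" and "y = A t s" and "z = A b s"
    have kk: "k = c * x * y * (1 - z)" by (simp add: k_def tail_weight_def c_def x_def y_def z_def)
    have "z \<le> 1" using A_le by (simp add: z_def)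
    have "c < n" using candidate_count_less[OF bts(1)] by (simp add: c_def)
    then have bd: "c * x < 2 ^ w" "c * x * y < 2 ^ w" "k < 2 ^ w" "1 < (2::nat) ^ w"
      using k_le n_bound k n unfolding c_def x_def y_def by linarith+
    have mem: "m (b * n + t) = x" "m (t * n + s) = y" "m (b * n + s) = z"
      using I bts representsD by (auto simp: x_def y_def z_def)
    have r: "r 0 = n" "r 3 = j" "r 5 = b" "r 6 = t" "r 7 = s" "r 8 = c"
      using I by (auto simp: c_def regsD)
    note ab = row_bound[OF bts(1)] row_bound[OF bts(2)] row_bound[OF j]
      address_bound[OF bts(1,2)] address_bound[OF bts(2,3)] address_bound[OF bts(1,3)]
      address_bound[OF j k]
    have comm: "j * n + x + n = n + j * n + x" for x by simp
    show "case run w ?prog (r, m) of (r, m) \<Rightarrow>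
        ?F r \<and> r 0 = n \<and> r 9 = ?p * n \<and> r 4 = (n + n * n) * n \<and> represents n A (table S) m"
      using bd mem r ab I w_pos \<open>z \<le> 1\<close> pb unfolding kk by (simp add: fetch_def comm)
  qed (simp_all add: fetch_def)
  have T: "(table S)(n + n * n := table S (n + n * n) + table S ?p) = table (S + (k choose j))"
    unfolding table_entry[OF k] by (simp add: table_def)
  have 4: "triple w
      (\<lambda>r m. ?F r \<and> r 0 = n \<and> r 9 = ?p * n \<and> r 4 = (n + n * n) * n \<and> represents n A (table S) m)
      add_blocks (20 * n + 3) (\<lambda>r m. ?F r \<and> represents n A (table (S + (k choose j))) m)"
    unfolding T[symmetric]
    by (rule triple_add_blocks) (use p pb w n in auto)
  show ?thesis
    unfolding process_triple_def k_def[symmetric]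
    by (rule triple_conseq[OF triple_Seq[OF 1 triple_Seq[OF 2 triple_Seq[OF 3 4]]]]) auto
qed

lemma triple_sum_triples:
  "triple w (\<lambda>r m. regs r \<and> represents n A (pascal n (n - 1) 0) m) sum_triples
     (6 + n * (4 + n * (4 + n * (40 * n + 32))))
     (\<lambda>r m. regs r \<and> r 4 = (n + n * n) * n \<and>
       represents n A (table (\<Sum>b<n. \<Sum>t<n. \<Sum>s<n. tail_weight A n b t s choose j)) m)"
proof -
  let ?F = "\<lambda>r. regs r \<and> r 4 = (n + n * n) * n"
  let ?g = "\<lambda>b t s. tail_weight A n b t s choose j"
  \<comment> \<open>Ghost totals for the three nested loops: each adds to the outer total the
    finished part of its own loop, so an inner total at \<open>n\<close> is the next outer
    one.\<close>
  let ?S1 = "\<lambda>b. \<Sum>b<b. \<Sum>t<n. \<Sum>s<n. ?g b t s"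
  let ?S2 = "\<lambda>b t. ?S1 b + (\<Sum>t<t. \<Sum>s<n. ?g b t s)"
  let ?S3 = "\<lambda>b t s. ?S2 b t + (\<Sum>s<s. ?g b t s)"
  let ?I1 = "\<lambda>b r m. ?F r \<and> represents n A (table (?S1 b)) m"
  let ?I2 = "\<lambda>b t r m. ?F r \<and> r 5 = b \<and> represents n A (table (?S2 b t)) m"
  let ?I3 = "\<lambda>b t s r m. ?F r \<and> r 5 = b \<and> r 6 = t \<and> represents n A (table (?S3 b t s)) m"
  have l3: "triple w (\<lambda>r m. ?I3 b t 0 (r(7 := 0)) m) (For 7 (Reg 0) process_triple)
      (2 + n * (40 * n + 30 + 2)) (\<lambda>r m. ?I3 b t n r m)" if "b < n" "t < n" for b t
  proof (rule triple_For)
    fix s assume s: "s < n"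
    have S: "?S3 b t (Suc s) = ?S3 b t s + ?g b t s" by simp
    show "triple w (\<lambda>r m. ?I3 b t s r m \<and> r 7 = s) process_triple (40 * n + 30)
        (\<lambda>r m. r 7 = s \<and> ?I3 b t (Suc s) (r(7 := Suc s)) m)"
      unfolding S by (rule triple_conseq[OF triple_process_triple[OF that s, of "?S3 b t s"]]) auto
  qed (use n_bound in \<open>auto simp: regsD\<close>)
  have l2: "triple w (\<lambda>r m. ?I2 b 0 (r(6 := 0)) m) (For 6 (Reg 0) (For 7 (Reg 0) process_triple))
      (2 + n * (2 + n * (40 * n + 30 + 2) + 2)) (\<lambda>r m. ?I2 b n r m)" if "b < n" for b
  proof (rule triple_For)
    fix t assume t: "t < n"
    have S: "?S2 b (Suc t) = ?S3 b t n" by simp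
    show "triple w (\<lambda>r m. ?I2 b t r m \<and> r 6 = t) (For 7 (Reg 0) process_triple)
        (2 + n * (40 * n + 30 + 2)) (\<lambda>r m. r 6 = t \<and> ?I2 b (Suc t) (r(6 := Suc t)) m)"
      unfolding S by (rule triple_conseq[OF l3[OF that t]]) auto
  qed (use n_bound in \<open>auto simp: regsD\<close>)
  have l1: "triple w (\<lambda>r m. ?I1 0 (r(5 := 0)) m)
      (For 5 (Reg 0) (For 6 (Reg 0) (For 7 (Reg 0) process_triple)))
      (2 + n * (2 + n * (2 + n * (40 * n + 30 + 2) + 2) + 2)) (\<lambda>r m. ?I1 n r m)"
  proof (rule triple_For)
    fix b assume b: "b < n"
    have S: "?S1 (Suc b) = ?S2 b n" by simp
    show "triple w (\<lambda>r m. ?I1 b r m \<and> r 5 = b) (For 6 (Reg 0) (For 7 (Reg 0) process_triple))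
        (2 + n * (2 + n * (40 * n + 30 + 2) + 2)) (\<lambda>r m. r 5 = b \<and> ?I1 (Suc b) (r(5 := Suc b)) m)"
      unfolding S by (rule triple_conseq[OF l2[OF b]]) auto
  qed (use n_bound in \<open>auto simp: regsD\<close>)
  have b: "n * n < 2 ^ w" "n * n + n < 2 ^ w" "(n * n + n) * n < 2 ^ w"
    using block_bound[of "n * n + n"] by simp_all
  have init: "triple w (\<lambda>r m. regs r \<and> represents n A (pascal n (n - 1) 0) m)
      (block [Op 4 Mul (Reg 0) (Reg 0), Op 4 Add (Reg 4) (Reg 0), Op 4 Mul (Reg 4) (Reg 0)]) 4
      (\<lambda>r m. ?I1 0 (r(5 := 0)) m)"
    by (rule triple_straight) (use b in \<open>auto simp: regsD table_0 add.commute\<close>)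
  show ?thesis
    unfolding sum_triples_def
    by (rule triple_conseq[OF triple_Seq[OF init l1]]) (auto simp: algebra_simps)
qed

lemma triple_count_scorpions:
  "triple w (\<lambda>r m. r 0 = n \<and> r 1 = j + 3 \<and> j + 3 < 2 ^ w \<and> represents n A (\<lambda>_. 0) m) count_scorpions
     (200 * n ^ 4)
     (\<lambda>r m. r 0 = (n + n * n) * n \<and> r 1 = n \<and>
       represents n A (table (\<Sum>b<n. \<Sum>t<n. \<Sum>s<n. tail_weight A n b t s choose j)) m)"
proof -
  let ?S = "\<Sum>b<n. \<Sum>t<n. \<Sum>s<n. tail_weight A n b t s choose j"
  have 3: "3 < (2::nat) ^ w" using n n_bound by linarith
  have 1: "triple w (\<lambda>r m. r 0 = n \<and> r 1 = j + 3 \<and> j + 3 < 2 ^ w \<and> represents n A (\<lambda>_. 0) m)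
      (block [Op 2 Sub (Reg 0) (Const 1), Op 3 Sub (Reg 1) (Const 3)]) 3
      (\<lambda>r m. regs r \<and> represents n A (\<lambda>_. 0) m)"
    by (rule triple_straight) (use n n_bound w_pos 3 in \<open>auto simp: regs_def\<close>)
  have b: "(n + n * n) * n < 2 ^ w" using block_bound[of "n + n * n"] by simp
  have 5: "triple w (\<lambda>r m. regs r \<and> r 4 = (n + n * n) * n \<and> represents n A (table ?S) m)
      (block [Op 1 Add (Reg 0) (Const 0), Op 0 Add (Reg 4) (Const 0)]) 3
      (\<lambda>r m. r 0 = (n + n * n) * n \<and> r 1 = n \<and> represents n A (table ?S) m)"
    by (rule triple_straight) (use b n_bound in \<open>auto simp: regs_def\<close>)
  have le: "x \<le> x * n" for x :: nat using mult_le_mono2[of 1 n x] n by simp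
  have "3 + (2 + n * 6 + (2 + n * (2 + n * (40 * n + 22) + 2) +
      (6 + n * (4 + n * (4 + n * (40 * n + 32))) + 3))) =
      40 * (n * n * n * n) + 72 * (n * n * n) + 26 * (n * n) + 14 * n + 16"
    by (simp add: algebra_simps)
  \<comment> \<open>Every lower power is at most the fourth one, and the coefficients 40, 72, 26,
    14, 16 add up to 168.\<close>
  also have "\<dots> \<le> 200 * (n * n * n * n)"
    using le[of n] le[of "n * n"] le[of "n * n * n"] n by linarith
  also have "n * n * n * n = n ^ 4" by (simp add: eval_nat_numeral)
  finally have T: "3 + (2 + n * 6 + (2 + n * (2 + n * (40 * n + 22) + 2) +
      (6 + n * (4 + n * (4 + n * (40 * n + 32))) + 3))) \<le> 200 * n ^ 4" .
  show ?thesis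
    unfolding count_scorpions_def
    by (rule triple_conseq[OF triple_Seq[OF 1 triple_Seq[OF triple_init_table
      triple_Seq[OF triple_fill_table triple_Seq[OF triple_sum_triples 5]]]] _ _ T]) auto
qed

end

section \<open>Input, output and the final bound\<close>

lemma sum_binary_digits: "(\<Sum>i<n. x div 2 ^ i mod 2 * 2 ^ i) = x mod 2 ^ n" for x :: nat
proof (induction n)
  case (Suc n)
  have "x mod 2 ^ Suc n = 2 ^ n * (x div 2 ^ n mod 2) + x mod 2 ^ n"
    by (simp only: power_Suc2 mod_mult2_eq)
  then show ?case using Suc by (simp add: mult.commute)
qed simp

lemma input_represents:
  assumes "simple_graph G"
  shows "represents n (adj G) (\<lambda>_. 0) (snd (input_state n k G))"
proof -
  have "u * n + v < n * n \<and> (u * n + v) div n = u \<and> (u * n + v) mod n = v" if "u < n" "v < n" for u v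
  proof -
    have "Suc u * n \<le> n * n" using that by (intro mult_le_mono1) simp
    then show ?thesis using that by simp
  qed
  moreover have "\<not> q * n + i < n * n" if "n \<le> q" for q i
    using mult_le_mono1[OF that, of n] by linarith
  ultimately show ?thesis
    by (simp add: represents_def input_state_def adj_def)
qed

lemma scorpion_program_correct:
  assumes G: "simple_graph G" and V: "verts G = {..<n}" and w: "(n + k + 2) ^ 4 \<le> 2 ^ w"
  shows "\<exists>t \<sigma>. exec w scorpion_program (input_state n k G) t \<sigma> \<and> t \<le> 200 * n ^ 4 + 3 \<and>
    output_is \<sigma> (indsub_count scorpion k G)"
proof -
  obtain r m where rm: "input_state n k G = (r, m)" "r 0 = n" "r 1 = k"
    by (simp add: input_state_def)
  have rep: "represents n (adj G) (\<lambda>_. 0) m" using input_represents[OF G, of n k] rm by simp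
  have "(2::nat) ^ 4 \<le> (n + k + 2) ^ 4" by (intro power_mono) simp_all
  \<comment> \<open>Keeps the constant 5 in the first test from being truncated.\<close>
  then have w16: "16 \<le> (2::nat) ^ w" using w by simp
  have zero: "triple w (\<lambda>r m. P) (Op 1 Mul (Const 0) (Const 0)) (200 * n ^ 4 + 1)
      (\<lambda>r m. output_is (r, m) (indsub_count scorpion k G))"
    if "P \<Longrightarrow> k < 5 \<or> n < k" for P
    by (rule triple_straight)
      (use that indsub_count_eq_0[of G k] V in \<open>simp_all add: output_is_def\<close>)
  \<comment> \<open>The bounds on \<open>k\<close> sit in the precondition because the two failed
    tests supply them; outside these bounds the triple is vacuous.\<close>
  have main: "triple w (\<lambda>r m. r 0 = n \<and> r 1 = k \<and> represents n (adj G) (\<lambda>_. 0) m \<and> 5 \<le> k \<and> k \<le> n)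
      count_scorpions (200 * n ^ 4 + 1) (\<lambda>r m. output_is (r, m) (indsub_count scorpion k G))"
  proof (cases "5 \<le> k \<and> k \<le> n")
    case True
    \<comment> \<open>Addresses grow like n^3, and \<open>k - 3\<close> is computed from
      \<open>k \<le> n\<close>; exponent 4 in the word size hypothesis covers both.\<close>
    have "(n + 2) ^ 4 \<le> (n + k + 2) ^ 4" by (intro power_mono) simp_all
    moreover have "(n + n * n) * n + n < (n + 2) ^ 4"
      by (simp add: eval_nat_numeral algebra_simps)
    moreover have "n + 3 < (n + 2) ^ 4"
      by (simp add: eval_nat_numeral algebra_simps)
    ultimately have *: "(n + n * n) * n + n < 2 ^ w" "n + 3 < 2 ^ w" using w by linarith+
    have "{u, u} \<notin> edges G" for u using simple_graph_edgeD(1)[OF G, of u u] by blast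
    then have loopless: "adj G u u = 0" for u by (simp add: adj_def)
    interpret counting n "k - 3" w "adj G"
    proof
      show "adj G u v \<le> 1" for u v by (simp add: adj_def)
      show "5 \<le> n" "k - 3 < n" using True by linarith+
    qed (fact loopless *(1))+
    have "indsub_count scorpion k G < 2 ^ n"
      using indsub_count_less[of G k] True V by simp
    then have out: "output_is (r, m) (indsub_count scorpion k G)"
      if "r 0 = (n + n * n) * n" "r 1 = n" "represents n (adj G) (table (indsub_count scorpion k G)) m" for r m
    proof -
      have "m ((n + n * n) * n + i) = indsub_count scorpion k G div 2 ^ i mod 2" if "i < n" for i
        using \<open>represents n (adj G) _ m\<close> that by (simp add: represents_def table_def)
      then show ?thesis
        using that(1,2) \<open>indsub_count scorpion k G < 2 ^ n\<close>
        by (auto simp: output_is_def sum_binary_digits)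
    qed
    show ?thesis
    proof (rule triple_conseq[OF triple_count_scorpions])
      show "output_is (r, m) (indsub_count scorpion k G)"
        if "r 0 = (n + n * n) * n \<and> r 1 = n \<and> represents n (adj G)
          (table (\<Sum>b<n. \<Sum>t<n. \<Sum>s<n. tail_weight (adj G) n b t s choose (k - 3))) m" for r m
        using that out indsub_count_scorpion_weight[OF G V, of k] True by simp
    qed (use True *(2) in auto)
  qed (auto simp: triple_def)
  have program: "triple w (\<lambda>r m. r 0 = n \<and> r 1 = k \<and> represents n (adj G) (\<lambda>_. 0) m) scorpion_program
      (1 + (1 + (200 * n ^ 4 + 1))) (\<lambda>r m. output_is (r, m) (indsub_count scorpion k G))"
    unfolding scorpion_program_def
  proof (intro triple_If, goal_cases)
    case 1 show ?case
      by (rule triple_conseq[OF zero[of "k < 5"]]) (use w16 in auto)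
  next
    case 2 show ?case
      by (rule triple_conseq[OF zero[of "n < k"]]) auto
  next
    case 3 show ?case
      by (rule triple_conseq[OF main]) (use w16 in auto)
  qed
  have "r 0 = n \<and> r 1 = k \<and> represents n (adj G) (\<lambda>_. 0) m" using rm rep by blast
  then obtain t r' m' where "exec w scorpion_program (r, m) t (r', m')"
      "t \<le> 1 + (1 + (200 * n ^ 4 + 1))" "output_is (r', m') (indsub_count scorpion k G)"
    by (rule tripleD[OF program])
  then show ?thesis
    unfolding rm by (intro exI[of _ t] exI[of _ "(r', m')"]) simp
qed

lemma indsub_solvable_scorpion:
  "indsub_solvable_in_time scorpion (\<lambda>n. 200 * n ^ 4 + 3)"
  unfolding indsub_solvable_in_time_def
proof (rule exI[of _ scorpion_program], rule exI[of _ 4], intro conjI allI impI)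
  show "(0::nat) < 4" by simp
qed (rule scorpion_program_correct)

theorem mainTheorem2:
  "\<not> meager scorpion \<and>
   (\<exists>T. (\<lambda>n. real (T n)) \<in> O(\<lambda>n. real n ^ 4) \<and> indsub_solvable_in_time scorpion T)"
proof (intro conjI exI)
  show "(\<lambda>n. real (200 * n ^ 4 + 3)) \<in> O(\<lambda>n. real n ^ 4)"
  proof (rule bigoI)
    \<comment> \<open>The constant 203 absorbs the additive 3 once n is at least 1.\<close>
    show "\<forall>\<^sub>F n in at_top. norm (real (200 * n ^ 4 + 3)) \<le> 203 * norm (real n ^ 4)"
      using eventually_ge_at_top[of 1]
    proof eventually_elim
      case (elim n)
      then have "1 \<le> real n ^ 4" by (intro one_le_power) simp
      then show ?case by simp
    qed
  qed
qed (fact not_meager_scorpion indsub_solvable_scorpion)+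

end
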